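(* Let $\omega=e^{2\pi i/3}$, $\mu(x)=\dfrac{x+\omega+1}{\omega(1-x)}$, and let $\Phi_3(x)=\dfrac{1728x(x-1)F_1^7}{G_0^3G_1^3}$ with $F_1=1+5x-8x^2+x^3$, $G_0=1-x+x^2$, $G_1=1-235x+1430x^2-1695x^3+270x^4+229x^5+x^6$. Then $\Phi_3^*(x):=1/\Phi_3(\mu(x))$ equals $$\Phi_3^*=\frac{(24\omega+8)\,x^3G_2^3}{(1-x^3)F_2^7},\quad F_2=1+\tfrac{39\omega-16}{49}x^3,\quad G_2=1-\tfrac{435\omega+745}{392}x^3+\tfrac{18357\omega+14632}{16807}x^6,$$ and around $x=0$ (all radical factors equal to $1$ at $x=0$): $$F_2^{1/6}\,{}_3F_2\!\left(-\tfrac1{42},\tfrac5{42},\tfrac{17}{42};\tfrac13,\tfrac23;\Phi_3^*\right)=\tfrac13\Big[(1-x)^{-\frac1{42}}(1-\omega x)^{\frac5{42}}(1-\omega^2x)^{\frac{17}{42}}+(1-x)^{\frac5{42}}(1-\omega x)^{\frac{17}{42}}(1-\omega^2x)^{-\frac1{42}}+(1-x)^{\frac{17}{42}}(1-\omega x)^{-\frac1{42}}(1-\omega^2x)^{\frac5{42}}\Big],$$ $$\frac{xG_2}{1-2\omega}F_2^{-13/6}\,{}_3F_2\!\left(\tfrac{13}{42},\tfrac{19}{42},\tfrac{31}{42};\tfrac23,\tfrac43;\Phi_3^*\right)=\tfrac13\Big[(1-x)^{\frac{13}{42}}(1-\omega x)^{\frac{19}{42}}(1-\omega^2x)^{\frac{31}{42}}+\omega(1-x)^{\frac{19}{42}}(1-\omega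 x)^{\frac{31}{42}}(1-\omega^2x)^{\frac{13}{42}}+\omega^2(1-x)^{\frac{31}{42}}(1-\omega x)^{\frac{13}{42}}(1-\omega^2x)^{\frac{19}{42}}\Big],$$ $$\frac{3x^2G_2^2}{21+7\omega}F_2^{-9/2}\,{}_3F_2\!\left(\tfrac{9}{14},\tfrac{11}{14},\tfrac{15}{14};\tfrac43,\tfrac53;\Phi_3^*\right)=\tfrac13\Big[(1-x)^{\frac{9}{14}}(1-\omega x)^{\frac{11}{14}}(1-\omega^2x)^{\frac{15}{14}}+\omega^2(1-x)^{\frac{11}{14}}(1-\omega x)^{\frac{15}{14}}(1-\omega^2x)^{\frac{9}{14}}+\omega(1-x)^{\frac{15}{14}}(1-\omega x)^{\frac{9}{14}}(1-\omega^2x)^{\frac{11}{14}}\Big].$$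
   Context: ${}_3F_2(\alpha_1,\alpha_2,\alpha_3;\beta_1,\beta_2;z)=\sum_{n\ge0}\frac{(\alpha_1)_n(\alpha_2)_n(\alpha_3)_n}{(\beta_1)_n(\beta_2)_n n!}z^n$. *)

theory Defs
  imports "HOL-Analysis.Analysis"
begin

definition hyp3F2 :: "complex \<Rightarrow> complex \<Rightarrow> complex \<Rightarrow> complex \<Rightarrow> complex \<Rightarrow> complex \<Rightarrow> complex" where
  "hyp3F2 a1 a2 a3 b1 b2 z =
     (\<Sum>n. pochhammer a1 n * pochhammer a2 n * pochhammer a3 n
           / (pochhammer b1 n * pochhammer b2 n * fact n) * z ^ n)"

definition omega :: complex where
  "omega = exp (2 * of_real pi * \<i> / 3)"

definition mu :: "complex \<Rightarrow> complex" where
  "mu x = (x + omega + 1) / (omega * (1 - x))"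

definition F1 :: "complex \<Rightarrow> complex" where
  "F1 x = 1 + 5*x - 8*x^2 + x^3"

definition G0 :: "complex \<Rightarrow> complex" where
  "G0 x = 1 - x + x^2"

definition G1 :: "complex \<Rightarrow> complex" where
  "G1 x = 1 - 235*x + 1430*x^2 - 1695*x^3 + 270*x^4 + 229*x^5 + x^6"

definition Phi3 :: "complex \<Rightarrow> complex" where
  "Phi3 x = 1728 * x * (x - 1) * (F1 x)^7 / ((G0 x)^3 * (G1 x)^3)"

definition Phi3star :: "complex \<Rightarrow> complex" where
  "Phi3star x = 1 / Phi3 (mu x)"

definition F2 :: "complex \<Rightarrow> complex" where
  "F2 x = 1 + (39* omega - 16)/49 * x^3"

definition G2 :: "complex \<Rightarrow> complex" where
  "G2 x = 1 - (435* omega + 745)/392 * x^3 + (18357* omega + 14632)/16807 * x^6"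

end

theory Submission
  imports Defs "HOL-Complex_Analysis.Laurent_Convergence"
begin

text \<open>
  Write \<open>z\<close> for \<open>\<Phi>\<^sub>3\<^sup>*\<close> and \<open>\<theta>\<close> for \<open>z d/dz\<close>. The hypergeometric operator
  \<open>\<theta>(\<theta> - 1/3)(\<theta> - 2/3) - z(\<theta> - 1/42)(\<theta> + 5/42)(\<theta> + 17/42)\<close> has the exponents 0, 1/3, 2/3 at
  \<open>z = 0\<close>. Since \<open>z = (24\<omega> + 8) P\<^sup>3\<close> with \<open>P = x + O(x\<^sup>4)\<close>, its pullback to the \<open>x\<close>-line
  has the exponents 0, 1, 2 at \<open>x = 0\<close>, so a power series solution is determined by its first three
  coefficients, and the three hypergeometric series (times 1, \<open>P\<close>, \<open>P\<^sup>2\<close>) form a basis. The function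
  \<open>g = (1 - x)\<^bsup>-1/42\<^esup> (1 - \<omega>x)\<^bsup>5/42\<^esup> (1 - \<omega>\<^sup>2x)\<^bsup>17/42\<^esup> F\<^sub>2\<^bsup>-1/6\<^esup>\<close> has a rational logarithmic
  derivative, and that it solves the pulled-back equation is a polynomial identity over the Eisenstein
  integers. Comparing coefficients expresses \<open>g\<close> in the basis; as \<open>z\<close> is invariant
  under \<open>x \<mapsto> \<omega>x\<close> while \<open>P\<close> is multiplied by \<open>\<omega>\<close>, averaging \<open>g\<close> over this rotation with the three
  characters isolates the three terms, which are the three claimed identities.
\<close>

section \<open>The hypergeometric equation and its pullback\<close>

definition fps_hyp3F2 :: "complex \<Rightarrow> complex \<Rightarrow> complex \<Rightarrow> complex \<Rightarrow> complex \<Rightarrow> complex fps" where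
  "fps_hyp3F2 a1 a2 a3 b1 b2 =
     Abs_fps (\<lambda>n. pochhammer a1 n * pochhammer a2 n * pochhammer a3 n
                  / (pochhammer b1 n * pochhammer b2 n * fact n))"

lemma fps_hyp3F2_nth_0 [simp]: "fps_nth (fps_hyp3F2 a1 a2 a3 b1 b2) 0 = 1"
  by (simp add: fps_hyp3F2_def)

lemma fps_hyp3F2_nth_Suc:
  "fps_nth (fps_hyp3F2 a1 a2 a3 b1 b2) (Suc n) =
     (a1 + of_nat n) * (a2 + of_nat n) * (a3 + of_nat n)
     / ((b1 + of_nat n) * (b2 + of_nat n) * (1 + of_nat n))
     * fps_nth (fps_hyp3F2 a1 a2 a3 b1 b2) n"
  by (simp add: fps_hyp3F2_def pochhammer_Suc mult_ac)

text \<open>\<open>fps_XDp c\<close> multiplies the coefficient of index \<open>n\<close> by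
  \<open>n + c\<close>, so at index \<open>Suc m\<close> the equation is the term ratio of the
  series. At index 0 both sides vanish, the left one because of the outermost
  \<open>fps_XDp 0\<close>.\<close>

lemma fps_hyp3F2_ODE:
  assumes "\<And>n. b1 + of_nat n \<noteq> 0" "\<And>n. b2 + of_nat n \<noteq> 0"
  shows "fps_XDp 0 (fps_XDp (b1 - 1) (fps_XDp (b2 - 1) (fps_hyp3F2 a1 a2 a3 b1 b2)))
         = fps_X * fps_XDp a1 (fps_XDp a2 (fps_XDp a3 (fps_hyp3F2 a1 a2 a3 b1 b2)))"
proof (rule fps_ext)
  fix n
  show "fps_nth (fps_XDp 0 (fps_XDp (b1 - 1) (fps_XDp (b2 - 1) (fps_hyp3F2 a1 a2 a3 b1 b2)))) n
      = fps_nth (fps_X * fps_XDp a1 (fps_XDp a2 (fps_XDp a3 (fps_hyp3F2 a1 a2 a3 b1 b2)))) n"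
  proof (cases n)
    case (Suc m)
    have "(1 + of_nat m :: complex) \<noteq> 0"
      by (metis of_nat_Suc of_nat_eq_0_iff nat.simps(3))
    with assms[of m] show ?thesis
      unfolding Suc by (simp add: fps_hyp3F2_nth_Suc)
  qed simp
qed

section \<open>Convergence of the hypergeometric series\<close>

lemma tendsto_shifted_ratio:
  fixes c d :: "'a :: real_normed_field"
  shows "(\<lambda>n. (c + of_nat n) / (d + of_nat n)) \<longlonglongrightarrow> 1"
proof -
  have "(\<lambda>n. (c / of_nat n + 1) / (d / of_nat n + 1)) \<longlonglongrightarrow> (0 + 1) / (0 + 1)"
    by (intro tendsto_intros lim_const_over_n) auto
  moreover have "eventually (\<lambda>n. (c / of_nat n + 1) / (d / of_nat n + 1)
                   = (c + of_nat n) / (d + of_nat n)) sequentially"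
    using eventually_gt_at_top[of 0]
  proof eventually_elim
    case (elim n)
    have "c / of_nat n + 1 = (c + of_nat n) / of_nat n" "d / of_nat n + 1 = (d + of_nat n) / of_nat n"
      using elim by (simp_all add: field_simps)
    thus ?case using elim by simp
  qed
  ultimately show ?thesis by (simp add: tendsto_cong)
qed

text \<open>The hypotheses keep all coefficients nonzero, and the ratio of consecutive ones tends to
  1, so the ratio criterion gives radius of convergence 1.\<close>

lemma has_fps_expansion_hyp3F2:
  assumes "\<And>n. a1 + of_nat n \<noteq> 0" "\<And>n. a2 + of_nat n \<noteq> 0" "\<And>n. a3 + of_nat n \<noteq> 0"
    and "\<And>n. b1 + of_nat n \<noteq> 0" "\<And>n. b2 + of_nat n \<noteq> 0"
  shows "hyp3F2 a1 a2 a3 b1 b2 has_fps_expansion fps_hyp3F2 a1 a2 a3 b1 b2"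
proof -
  let ?H = "fps_hyp3F2 a1 a2 a3 b1 b2"
  have "pochhammer c n \<noteq> 0" if "\<And>k. c + of_nat k \<noteq> 0" for c :: complex and n
    using that by (induction n) (simp_all add: pochhammer_Suc)
  hence nz: "fps_nth ?H n \<noteq> 0" for n
    using assms by (simp add: fps_hyp3F2_def)
  have lim: "(\<lambda>n. norm ((b1 + of_nat n) / (a1 + of_nat n) * ((b2 + of_nat n) / (a2 + of_nat n))
              * ((1 + of_nat n) / (a3 + of_nat n)))) \<longlonglongrightarrow> norm (1 * 1 * 1 :: complex)"
    by (intro tendsto_intros tendsto_shifted_ratio)
  have "norm (fps_nth ?H n) / norm (fps_nth ?H (Suc n)) =
          norm ((b1 + of_nat n) / (a1 + of_nat n) * ((b2 + of_nat n) / (a2 + of_nat n))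
              * ((1 + of_nat n) / (a3 + of_nat n)))" for n
    using nz[of n] by (simp add: fps_hyp3F2_nth_Suc norm_mult norm_divide)
  with lim have "conv_radius (fps_nth ?H) = 1"
    by (intro conv_radius_ratio_limit_nonzero[where c = 1]) simp_all
  moreover have "eval_fps ?H = hyp3F2 a1 a2 a3 b1 b2"
    by (simp add: fun_eq_iff eval_fps_def hyp3F2_def fps_hyp3F2_def)
  ultimately show ?thesis
    using eval_fps_has_fps_expansion[of ?H] by (simp add: fps_conv_radius_def)
qed

lemma fps_mult_nth_leading:
  fixes A E :: "'a :: comm_ring_1 fps"
  assumes "\<And>i. i < n \<Longrightarrow> fps_nth E i = 0" "m \<le> n"
  shows "fps_nth (A * E) m = fps_nth A 0 * fps_nth E m"
proof -
  have "fps_nth (A * E) m = (\<Sum>i=0..m. if i = 0 then fps_nth A 0 * fps_nth E m else 0)"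
    unfolding fps_mult_nth by (rule sum.cong) (use assms in auto)
  thus ?thesis by simp
qed

lemma fps_XD_mult: "fps_XD (a * b) = fps_XD a * b + a * fps_XD (b :: 'a :: comm_ring_1 fps)"
  by (simp add: fps_XD_def algebra_simps)

text \<open>The operator \<open>r x d/dx\<close> is the Euler operator \<open>z d/dz\<close> expressed in the variable \<open>x\<close>.\<close>

locale euler_pullback =
  fixes r P :: "complex fps" and \<kappa> a1 a2 a3 :: complex
  assumes r_nth_0: "fps_nth r 0 = 1/3"
    and P_nth_0: "fps_nth P 0 = 0"
    and P_ODE: "r * fps_XD P = fps_const (1/3) * P"
begin

definition z :: "complex fps" where "z = fps_const \<kappa> * P ^ 3"

definition theta :: "complex \<Rightarrow> complex fps \<Rightarrow> complex fps" where
  "theta c D = r * fps_XD D + fps_const c * D"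

text \<open>The shifts -1/3 and -2/3 are \<open>b - 1\<close> for the lower parameters 2/3 and
  1/3.\<close>

definition hyp_op :: "complex fps \<Rightarrow> complex fps" where
  "hyp_op D = theta 0 (theta (-1/3) (theta (-2/3) D)) - z * theta a1 (theta a2 (theta a3 D))"

lemma z_nth_0: "fps_nth z 0 = 0"
  by (simp add: z_def P_nth_0)

lemma theta_add: "theta c (A + B) = theta c A + theta c B"
  by (simp add: theta_def algebra_simps)

lemma theta_cmult: "theta c (fps_const k * A) = fps_const k * theta c A"
  by (simp add: theta_def distrib_left mult.left_commute)

lemma hyp_op_add: "hyp_op (A + B) = hyp_op A + hyp_op B"
  by (simp add: hyp_op_def theta_add algebra_simps)

lemma hyp_op_cmult: "hyp_op (fps_const k * A) = fps_const k * hyp_op A"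
  by (simp add: hyp_op_def theta_cmult right_diff_distrib mult.left_commute)

text \<open>\<open>r * fps_XD\<close> commutes with constants, so the product expands with the
  elementary symmetric functions of \<open>a\<close>, \<open>b\<close>, \<open>c\<close>. This
  reduces \<open>hyp_op\<close> to iterated Euler derivatives.\<close>

lemma theta_theta_theta:
  "theta a (theta b (theta c D)) =
     r * fps_XD (r * fps_XD (r * fps_XD D)) + fps_const (a + b + c) * (r * fps_XD (r * fps_XD D))
     + fps_const (a * b + a * c + b * c) * (r * fps_XD D) + fps_const (a * b * c) * D"
proof -
  have add: "r * fps_XD (A + B) = r * fps_XD A + r * fps_XD B" for A B
    by (simp add: distrib_left)
  have cmult: "r * fps_XD (fps_const k * A) = fps_const k * (r * fps_XD A)" for k A
    by (simp add: mult.left_commute)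
  show ?thesis
    unfolding theta_def add cmult fps_const_add [symmetric] fps_const_mult [symmetric]
    by (simp add: algebra_simps del: fps_const_add fps_const_mult)
qed

text \<open>\<open>P\<close> acts as a cube root of \<open>z\<close>: by \<open>P_ODE\<close> it is
  an eigenvector of the Euler operator with eigenvalue 1/3, and the Leibniz rule adds
  eigenvalues.\<close>

lemma theta_P_power: "r * fps_XD (P ^ k) = fps_const (of_nat k / 3) * P ^ k"
proof (induction k)
  case (Suc k)
  have "r * fps_XD (P ^ Suc k) = (r * fps_XD P) * P ^ k + P * (r * fps_XD (P ^ k))"
    by (simp add: fps_XD_mult algebra_simps)
  also have "\<dots> = (fps_const (1/3) + fps_const (of_nat k / 3)) * P ^ Suc k"
    unfolding P_ODE Suc.IH by (simp add: algebra_simps del: fps_const_add)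
  also have "fps_const (1/3) + fps_const (of_nat k / 3) = fps_const (of_nat (Suc k) / 3 :: complex)"
    by (simp add: add_divide_distrib)
  finally show ?case .
qed (simp add: fps_XD_def)

lemma theta_z: "r * fps_XD z = z"
  using theta_P_power[of 3] by (simp add: z_def fps_XD_mult algebra_simps) (simp add: fps_XD_def)

lemma theta_compose: "r * fps_XD (H oo z) = fps_XD H oo z"
proof -
  have "r * fps_XD (H oo z) = (fps_deriv H oo z) * (r * fps_XD z)"
    by (simp add: fps_XD_def fps_compose_deriv z_nth_0)
  also have "\<dots> = fps_XD H oo z"
    unfolding theta_z by (simp add: fps_XD_def fps_compose_mult_distrib z_nth_0)
  finally show ?thesis .
qed

lemma theta_P_power_compose:
  "theta c (P ^ k * (H oo z)) = P ^ k * (fps_XDp (c + of_nat k / 3) H oo z)"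
proof -
  have "theta c (P ^ k * (H oo z)) =
          (r * fps_XD (P ^ k)) * (H oo z) + P ^ k * (r * fps_XD (H oo z)) + fps_const c * (P ^ k * (H oo z))"
    by (simp add: theta_def fps_XD_mult algebra_simps)
  also have "\<dots> = P ^ k * ((fps_XD H oo z) + (fps_const c + fps_const (of_nat k / 3)) * (H oo z))"
    unfolding theta_P_power theta_compose by (simp add: algebra_simps del: fps_const_add)
  finally show ?thesis
    by (simp add: fps_XDp_def fps_compose_add_distrib fps_compose_mult_distrib z_nth_0)
qed

text \<open>Pulling \<open>P ^ k\<close> out of \<open>theta c\<close> raises \<open>c\<close> by
  \<open>k / 3\<close>. The assumption is therefore the hypergeometric equation in \<open>z\<close>
  with all shifts raised by \<open>k / 3\<close>.\<close>

lemma hyp_op_P_power_compose: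
  assumes "fps_XDp (of_nat k / 3) (fps_XDp (of_nat k / 3 - 1/3) (fps_XDp (of_nat k / 3 - 2/3) H)) =
           fps_X * fps_XDp (a1 + of_nat k / 3) (fps_XDp (a2 + of_nat k / 3) (fps_XDp (a3 + of_nat k / 3) H))"
  shows "hyp_op (P ^ k * (H oo z)) = 0"
proof -
  have "-1/3 + of_nat k / 3 = (of_nat k / 3 - 1/3 :: complex)" "-2/3 + of_nat k / 3 = (of_nat k / 3 - 2/3 :: complex)"
    by simp_all
  hence "hyp_op (P ^ k * (H oo z)) = P ^ k *
     ((fps_XDp (of_nat k / 3) (fps_XDp (of_nat k / 3 - 1/3) (fps_XDp (of_nat k / 3 - 2/3) H)) oo z)
      - (fps_X * fps_XDp (a1 + of_nat k / 3) (fps_XDp (a2 + of_nat k / 3) (fps_XDp (a3 + of_nat k / 3) H)) oo z))"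
    by (simp add: hyp_op_def theta_P_power_compose fps_compose_mult_distrib z_nth_0 algebra_simps)
  thus ?thesis unfolding assms by simp
qed

section \<open>Uniqueness of solutions from three coefficients\<close>

lemma theta_nth_leading:
  assumes "\<And>i. i < n \<Longrightarrow> fps_nth D i = 0" "m \<le> n"
  shows "fps_nth (theta c D) m = (of_nat m / 3 + c) * fps_nth D m"
proof -
  have "fps_nth (r * fps_XD D) m = fps_nth r 0 * fps_nth (fps_XD D) m"
    by (rule fps_mult_nth_leading[of n]) (use assms in auto)
  thus ?thesis by (simp add: theta_def r_nth_0 algebra_simps)
qed

text \<open>Indicial argument: if all coefficients of \<open>D\<close> below \<open>n\<close>
  vanish, the part multiplied by \<open>z\<close> contributes nothing at index \<open>n\<close>,
  since \<open>z\<close> has no constant term. There \<open>hyp_op D\<close> has the coefficient of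
  \<open>D\<close> times \<open>n/3 * (n/3 - 1/3) * (n/3 - 2/3)\<close>, a nonzero factor for
  \<open>n \<ge> 3\<close>.\<close>

lemma hyp_op_eq_0_imp_eq_0:
  assumes "hyp_op D = 0" "fps_nth D 0 = 0" "fps_nth D 1 = 0" "fps_nth D 2 = 0"
  shows "D = 0"
proof (rule fps_ext)
  fix n show "fps_nth D n = fps_nth 0 n"
  proof (induction n rule: less_induct)
    case (less n)
    consider "n = 0" | "n = 1" | "n = 2" | "n \<ge> 3" by linarith
    thus ?case
    proof cases
      case 4
      have D: "fps_nth D i = 0" if "i < n" for i
        using less that by simp
      have D3: "fps_nth (theta a3 D) i = 0" if "i < n" for i
        using theta_nth_leading[of n D i a3] D that by simp
      have D2: "fps_nth (theta a2 (theta a3 D)) i = 0" if "i < n" for i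
        using theta_nth_leading[of n "theta a3 D" i a2] D3 that by simp
      have D1: "fps_nth (theta a1 (theta a2 (theta a3 D))) i = 0" if "i < n" for i
        using theta_nth_leading[of n "theta a2 (theta a3 D)" i a1] D2 that by simp
      have E2: "fps_nth (theta (-2/3) D) i = (of_nat i / 3 - 2/3) * fps_nth D i" if "i \<le> n" for i
        using theta_nth_leading[of n D i "-2/3"] D that by simp
      have E1: "fps_nth (theta (-1/3) (theta (-2/3) D)) i
          = (of_nat i / 3 - 1/3) * ((of_nat i / 3 - 2/3) * fps_nth D i)" if "i \<le> n" for i
        using theta_nth_leading[of n "theta (-2/3) D" i "-1/3"] E2 D that by simp
      have E0: "fps_nth (theta 0 (theta (-1/3) (theta (-2/3) D))) n
          = of_nat n / 3 * ((of_nat n / 3 - 1/3) * ((of_nat n / 3 - 2/3) * fps_nth D n))"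
        using theta_nth_leading[of n "theta (-1/3) (theta (-2/3) D)" n 0] E1 D by simp
      have "fps_nth (z * theta a1 (theta a2 (theta a3 D))) n = 0"
        using fps_mult_nth_leading[of n "theta a1 (theta a2 (theta a3 D))" n z] D1
        by (simp add: z_nth_0)
      with E0 assms(1) have
        "of_nat n / 3 * ((of_nat n / 3 - 1/3) * ((of_nat n / 3 - 2/3) * fps_nth D n)) = 0"
        by (simp add: hyp_op_def)
      moreover have "(of_nat n :: complex) \<noteq> of_nat 0" "(of_nat n :: complex) \<noteq> of_nat 1"
        "(of_nat n :: complex) \<noteq> of_nat 2"
        using 4 unfolding of_nat_eq_iff by auto
      ultimately show ?thesis by simp
    qed (use assms in simp_all)
  qed
qed

text \<open>\<open>P\<close> has no constant term, so \<open>z\<close> is divisible by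
  \<open>fps_X ^ 3\<close>.\<close>

lemma compose_z_nth:
  assumes "n < 3"
  shows "fps_nth (H oo z) n = (if n = 0 then fps_nth H 0 else 0)"
proof -
  define P' where "P' = fps_shift 1 P"
  have "P = fps_X * P'"
    by (rule fps_ext) (simp add: P'_def P_nth_0)
  hence P_cube: "P ^ 3 = fps_X ^ 3 * P' ^ 3"
    by (simp add: power_mult_distrib)
  have "H = fps_const (fps_nth H 0) + fps_X * fps_shift 1 H"
    by (rule fps_ext) simp
  hence "H oo z = (fps_const (fps_nth H 0) + fps_X * fps_shift 1 H) oo z"
    by simp
  also have "\<dots> = fps_const (fps_nth H 0) + z * (fps_shift 1 H oo z)"
    by (simp add: fps_compose_add_distrib fps_compose_mult_distrib z_nth_0)
  also have "z * (fps_shift 1 H oo z) = fps_X ^ 3 * (fps_const \<kappa> * P' ^ 3 * (fps_shift 1 H oo z))"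
    unfolding z_def by (simp add: P_cube mult_ac)
  finally show ?thesis
    using assms by (simp add: fps_X_power_mult_nth)
qed

end

section \<open>Powers of power series and polynomials over the Eisenstein integers\<close>

text \<open>Meant for \<open>u\<close> with constant coefficient 1, where it expands the principal
  branch, equal to 1 at 0.\<close>

definition fps_powr :: "complex fps \<Rightarrow> complex \<Rightarrow> complex fps" where
  "fps_powr u c = fps_binomial c oo (u - 1)"

lemma fps_powr_nth_0 [simp]: "fps_nth (fps_powr u c) 0 = 1"
  by (simp add: fps_powr_def)

lemma fps_XD_fps_powr:
  assumes "fps_nth u 0 = 1"
  shows "u * fps_XD (fps_powr u c) = fps_const c * fps_XD u * fps_powr u c"
proof -
  have "fps_deriv (fps_binomial c) * (1 + fps_X) = fps_const c * fps_binomial c"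
    by (simp add: fps_binomial_deriv fps_divide_unit mult.assoc inverse_mult_eq_1)
  hence "(fps_deriv (fps_binomial c) * (1 + fps_X)) oo (u - 1) = (fps_const c * fps_binomial c) oo (u - 1)"
    by simp
  hence "(fps_deriv (fps_binomial c) oo (u - 1)) * u = fps_const c * fps_powr u c"
    using assms by (simp add: fps_compose_mult_distrib fps_compose_add_distrib fps_powr_def)
  moreover have "fps_XD (fps_powr u c) = (fps_deriv (fps_binomial c) oo (u - 1)) * fps_XD u"
    using assms by (simp add: fps_powr_def fps_XD_def fps_compose_deriv mult_ac)
  ultimately show ?thesis
    by (metis mult.assoc mult.commute)
qed

text \<open>Exponents add up to \<open>k * c + n = 0\<close>. This removes the cube roots from
  \<open>fps_P ^ 3\<close>.\<close>

lemma fps_powr_power_cancel: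
  assumes "fps_nth u 0 = 1" "of_nat k * c = - of_nat n"
  shows "fps_powr u c ^ k * u ^ n = 1"
proof -
  have "fps_binomial c ^ k * (1 + fps_X) ^ n = 1"
    using assms(2)
    by (simp add: fps_binomial_power flip: fps_binomial_of_nat fps_binomial_add_mult)
  hence "(fps_binomial c ^ k * (1 + fps_X) ^ n) oo (u - 1) = 1"
    by simp
  thus ?thesis
    using assms(1) by (simp add: fps_powr_def fps_compose_mult_distrib fps_compose_add_distrib
        flip: fps_compose_power)
qed

lemma has_fps_expansion_fps_powr:
  assumes "f has_fps_expansion u" "fps_nth u 0 = 1"
  shows "(\<lambda>x. f x powr c) has_fps_expansion fps_powr u c"
proof -
  have "((\<lambda>x. (1 + x) powr c) \<circ> (\<lambda>x. f x - 1)) has_fps_expansion fps_powr u c"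
    unfolding fps_powr_def using assms
    by (intro has_fps_expansion_compose has_fps_expansion_binomial_complex has_fps_expansion_diff
        has_fps_expansion_1) auto
  thus ?thesis by (simp add: o_def)
qed

section \<open>Computable arithmetic of Eisenstein polynomials\<close>

lemma omega_square: "omega\<^sup>2 = -1 - omega"
proof -
  have "omega = cis (2 * pi / 3)"
    by (simp add: omega_def cis_conv_exp mult_ac)
  also have "\<dots> = Complex (-1/2) (sqrt 3 / 2)"
    using cos_120 sin_120 by (simp add: complex_eq_iff)
  finally have *: "omega = Complex (-1/2) (sqrt 3 / 2)" .
  show ?thesis
    unfolding * by (simp add: power2_eq_square complex_eq_iff)
qed

lemma omega_cube: "omega ^ 3 = 1"
proof -
  have "omega ^ 3 = omega * omega\<^sup>2" by (simp add: power3_eq_cube power2_eq_square)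
  thus ?thesis using omega_square by algebra
qed

text \<open>A pair \<open>(a, b)\<close> stands for \<open>a + b * omega\<close>, and a list of
  pairs for a polynomial, constant term first. With integer data the large identities can be checked
  by evaluation.\<close>

type_synonym eis = "int \<times> int"

fun eis_val :: "eis \<Rightarrow> complex" where
  "eis_val (a, b) = of_int a + of_int b * omega"

fun eis_mult :: "eis \<Rightarrow> eis \<Rightarrow> eis" where
  "eis_mult (a, b) (c, d) = (a * c - b * d, a * d + b * c - b * d)"

fun eispoly_add :: "eis list \<Rightarrow> eis list \<Rightarrow> eis list" where
  "eispoly_add [] q = q"
| "eispoly_add p [] = p"
| "eispoly_add ((a, b) # p) ((c, d) # q) = (a + c, b + d) # eispoly_add p q"

fun eispoly_smult :: "eis \<Rightarrow> eis list \<Rightarrow> eis list" where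
  "eispoly_smult c [] = []"
| "eispoly_smult c (a # p) = eis_mult c a # eispoly_smult c p"

text \<open>The shortcut for zero coefficients keeps evaluation cheap: most of the polynomials
  contain only powers of \<open>x^3\<close>.\<close>

fun eispoly_mult :: "eis list \<Rightarrow> eis list \<Rightarrow> eis list" where
  "eispoly_mult [] q = []"
| "eispoly_mult (a # p) q =
     (if a = (0, 0) then (0, 0) # eispoly_mult p q
      else eispoly_add (eispoly_smult a q) ((0, 0) # eispoly_mult p q))"

text \<open>\<open>k\<close> is the degree carried by the head of the list.\<close>

fun eispoly_XD_aux :: "int \<Rightarrow> eis list \<Rightarrow> eis list" where
  "eispoly_XD_aux k [] = []"
| "eispoly_XD_aux k ((a, b) # p) = (k * a, k * b) # eispoly_XD_aux (k + 1) p"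

abbreviation eispoly_XD :: "eis list \<Rightarrow> eis list" where
  "eispoly_XD \<equiv> eispoly_XD_aux 0"

fun eispoly_fps :: "eis list \<Rightarrow> complex fps" where
  "eispoly_fps [] = 0"
| "eispoly_fps (a # p) = fps_const (eis_val a) + fps_X * eispoly_fps p"

lemma fps_const_eis_val_numeral:
  "fps_const (eis_val (numeral a, 0)) = numeral a"
  "fps_const (eis_val (- numeral a, 0)) = - numeral a"
  "fps_const (eis_val (- 1, 0)) = - 1"
  by (simp_all add: numeral_fps_const flip: fps_const_neg)

lemma eis_val_mult: "eis_val (eis_mult p q) = eis_val p * eis_val q"
proof (cases p; cases q)
  fix a b c d assume [simp]: "p = (a, b)" "q = (c, d)"
  have "eis_val p * eis_val q =
    of_int (a * c) + of_int (a * d + b * c) * omega + of_int (b * d) * omega\<^sup>2"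
    by (simp add: algebra_simps power2_eq_square)
  thus ?thesis unfolding omega_square by (simp add: algebra_simps)
qed

lemma eispoly_fps_add: "eispoly_fps (eispoly_add p q) = eispoly_fps p + eispoly_fps q"
  by (induction p q rule: eispoly_add.induct) (simp_all add: algebra_simps flip: fps_const_add)

lemma eispoly_fps_smult: "eispoly_fps (eispoly_smult c p) = fps_const (eis_val c) * eispoly_fps p"
  by (induction p) (simp_all add: eis_val_mult algebra_simps flip: fps_const_mult)

lemma eispoly_fps_mult: "eispoly_fps (eispoly_mult p q) = eispoly_fps p * eispoly_fps q"
  by (induction p) (auto simp: eispoly_fps_add eispoly_fps_smult algebra_simps)

lemma eispoly_fps_XD_aux:
  "eispoly_fps (eispoly_XD_aux k p) = fps_XD (eispoly_fps p) + of_int k * eispoly_fps p"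
proof (induction k p rule: eispoly_XD_aux.induct)
  case (2 k a b p)
  have "fps_const (eis_val (k * a, k * b)) = of_int k * fps_const (eis_val (a, b))"
    by (simp add: algebra_simps flip: fps_of_int)
  with 2 show ?case by (simp add: fps_XD_def algebra_simps)
qed (simp add: fps_XD_def)

lemma eispoly_fps_XD: "eispoly_fps (eispoly_XD p) = fps_XD (eispoly_fps p)"
  by (simp add: eispoly_fps_XD_aux)

lemmas eispoly_fps_simps =
  eispoly_fps_add eispoly_fps_smult eispoly_fps_mult eispoly_fps_XD

text \<open>The list operations do not strip zero coefficients, so the zero polynomial need not be
  the empty list and is tested entry by entry.\<close>

lemma eispoly_fps_eq_0:
  "list_all (\<lambda>a. a = (0, 0)) p \<Longrightarrow> eispoly_fps p = 0"
  by (induction p) auto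

section \<open>The polynomial identities\<close>

text \<open>
  Denominators are cleared: \<open>F = 49 F\<^sub>2\<close>, \<open>G = 134456 G\<^sub>2\<close>, \<open>U = 1 - x\<^sup>3\<close>. The polynomial \<open>Q\<close> is given by
  \<open>x z'/z = 3 Q / (G U F)\<close>; since \<open>z\<close> ramifies to order two over 1, it also satisfies
  \<open>1 - z = 7 Q\<^sup>2 / (448 U F\<^sup>7)\<close>. Finally \<open>x g'/g = M / (14 U F)\<close>.
\<close>

definition poly_F :: "eis list" where
  "poly_F = [(49, 0), (0, 0), (0, 0), (-16, 39)]"

definition poly_G :: "eis list" where
  "poly_G = [(134456, 0), (0, 0), (0, 0), (-255535, -149205), (0, 0), (0, 0), (117056, 146856)]"

definition poly_U :: "eis list" where
  "poly_U = [(1, 0), (0, 0), (0, 0), (-1, 0)]"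

definition poly_Q :: "eis list" where
  "poly_Q = [(6588344, 0), (0, 0), (0, 0), (-37177084, -60706884), (0, 0), (0, 0),
     (32932116, 114290001), (0, 0), (0, 0), (5215756, -50214024), (0, 0), (0, 0),
     (-7600280, -3511896)]"

definition poly_M :: "eis list" where
  "poly_M = [(0, 0), (294, 196), (98, -196), (-231, -273), (-252, 14), (124, 298)]"

definition poly_X3 :: "eis list" where
  "poly_X3 = [(0, 0), (0, 0), (0, 0), (1, 0)]"

text \<open>If \<open>Q\<^sup>j Y = G k g\<close>, then \<open>Q\<^bsup>j+2\<^esup> (42 \<theta>Y) = G (poly_next j k) g\<close>.\<close>

definition poly_next :: "int \<Rightarrow> eis list \<Rightarrow> eis list" where
  "poly_next j k =
     eispoly_add
       (eispoly_smult (14, 0) (eispoly_mult (eispoly_mult poly_U poly_F)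
         (eispoly_add (eispoly_mult poly_Q (eispoly_XD (eispoly_mult poly_G k)))
           (eispoly_smult (-j, 0) (eispoly_mult (eispoly_XD poly_Q) (eispoly_mult poly_G k))))))
       (eispoly_mult poly_Q (eispoly_mult poly_G (eispoly_mult poly_M k)))"

text \<open>\<open>poly_K\<close> and \<open>poly_D\<close> are numerator and denominator of
  \<open>z\<close> after clearing the denominators in \<open>F2\<close> and
  \<open>G2\<close>.\<close>

definition poly_K :: "eis list" where
  "poly_K = eispoly_smult (1, 3)
     (eispoly_mult poly_X3 (eispoly_mult poly_G (eispoly_mult poly_G poly_G)))"

definition poly_D :: "eis list" where
  "poly_D = eispoly_smult (448, 0) (eispoly_mult poly_U (eispoly_mult poly_F
     (eispoly_mult poly_F (eispoly_mult poly_F (eispoly_mult poly_F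
       (eispoly_mult poly_F (eispoly_mult poly_F poly_F)))))))"

text \<open>
  The hypergeometric operator applied to \<open>g\<close>, up to a nonzero factor, when \<open>k2\<close> and \<open>k3\<close> represent
  \<open>(42 \<theta>)\<^sup>2 g\<close> and \<open>(42 \<theta>)\<^sup>3 g\<close>.
\<close>

definition poly_residue :: "eis list \<Rightarrow> eis list \<Rightarrow> eis list" where
  "poly_residue k2 k3 =
     eispoly_add
       (eispoly_add (eispoly_smult (7, 0) k3)
         (eispoly_mult (eispoly_add (eispoly_smult (-42, 0) poly_D) (eispoly_smult (-21, 0) poly_K)) k2))
       (eispoly_add
         (eispoly_mult (eispoly_add (eispoly_smult (392, 0) poly_D) (eispoly_smult (-63, 0) poly_K))
           (eispoly_mult (eispoly_mult poly_Q poly_Q) poly_M))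
         (eispoly_smult (85, 255) (eispoly_mult poly_X3 (eispoly_mult poly_G (eispoly_mult poly_G
           (eispoly_mult poly_Q (eispoly_mult poly_Q poly_Q)))))))"

text \<open>\<open>poly_M\<close> represents \<open>42 \<theta>g\<close>. The arguments 1 and 3 of
  \<open>poly_next\<close> are the powers of \<open>Q\<close> in the denominators of
  \<open>42 \<theta>g\<close> and of the second iterate.\<close>

lemma poly_residue_certificate:
  "list_all (\<lambda>a. a = (0, 0)) (poly_residue (poly_next 1 poly_M) (poly_next 3 (poly_next 1 poly_M)))"
  by code_simp

text \<open>With \<open>z = K / D\<close> this is \<open>1 - z = 7 Q^2 / D\<close>.\<close>

lemma poly_D_certificate:
  "list_all (\<lambda>a. a = (0, 0))
     (eispoly_add poly_D (eispoly_add (eispoly_smult (-1, 0) poly_K)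
       (eispoly_smult (-7, 0) (eispoly_mult poly_Q poly_Q))))"
  by code_simp

text \<open>The logarithmic derivative of \<open>x G U^(-1/3) F^(-7/3)\<close> under
  \<open>x d/dx\<close>, multiplied by \<open>3 G U F\<close>, is \<open>3 Q\<close>.\<close>

lemma poly_Q_certificate:
  "list_all (\<lambda>a. a = (0, 0))
     (eispoly_add
       (eispoly_add
         (eispoly_smult (3, 0) (eispoly_mult (eispoly_add poly_G (eispoly_XD poly_G)) (eispoly_mult poly_U poly_F)))
         (eispoly_smult (3, 0) (eispoly_mult poly_X3 (eispoly_mult poly_G poly_F))))
       (eispoly_add
         (eispoly_smult (-7, 0) (eispoly_mult (eispoly_XD poly_F) (eispoly_mult poly_G poly_U)))
         (eispoly_smult (-3, 0) poly_Q)))"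
  by code_simp

definition fps_F :: "complex fps" where "fps_F = eispoly_fps poly_F"
definition fps_G :: "complex fps" where "fps_G = eispoly_fps poly_G"
definition fps_U :: "complex fps" where "fps_U = eispoly_fps poly_U"
definition fps_Q :: "complex fps" where "fps_Q = eispoly_fps poly_Q"
definition fps_M :: "complex fps" where "fps_M = eispoly_fps poly_M"

definition fps_next :: "nat \<Rightarrow> complex fps \<Rightarrow> complex fps" where
  "fps_next j k = 14 * (fps_U * fps_F * (fps_Q * fps_XD (fps_G * k) - of_nat j * (fps_XD fps_Q * (fps_G * k))))
     + fps_Q * (fps_G * (fps_M * k))"

definition fps_D :: "complex fps" where "fps_D = 448 * fps_U * fps_F ^ 7"
definition fps_K :: "complex fps" where "fps_K = fps_const (1 + 3 * omega) * fps_X ^ 3 * fps_G ^ 3"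

lemma eispoly_fps_X3: "eispoly_fps poly_X3 = fps_X ^ 3"
  by (simp add: poly_X3_def power3_eq_cube)

lemma eispoly_fps_D: "eispoly_fps poly_D = fps_D"
  by (simp add: poly_D_def fps_D_def eispoly_fps_simps fps_U_def fps_F_def eval_nat_numeral
      flip: numeral_fps_const)

lemma eispoly_fps_K: "eispoly_fps poly_K = fps_K"
  by (simp add: poly_K_def fps_K_def eispoly_fps_simps fps_G_def eispoly_fps_X3 power3_eq_cube mult_ac)

lemma eispoly_fps_next: "eispoly_fps (poly_next (int j) k) = fps_next j (eispoly_fps k)"
proof -
  have "fps_const (eis_val (- int j, 0)) = - of_nat j"
    by (simp flip: fps_of_nat)
  moreover have "fps_const (eis_val (14, 0)) = 14"
    by (simp flip: numeral_fps_const)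
  ultimately show ?thesis
    by (simp add: poly_next_def fps_next_def eispoly_fps_simps fps_G_def fps_M_def fps_Q_def fps_U_def fps_F_def
        del: eis_val.simps)
qed

lemma fps_D_eq: "fps_D = fps_K + 7 * fps_Q\<^sup>2"
  using eispoly_fps_eq_0[OF poly_D_certificate]
  by (simp add: eispoly_fps_simps eispoly_fps_D eispoly_fps_K fps_const_eis_val_numeral
      power2_eq_square algebra_simps flip: fps_Q_def del: eis_val.simps)

lemma fps_Q_eq:
  "3 * ((fps_G + fps_XD fps_G) * (fps_U * fps_F)) + 3 * (fps_X ^ 3 * (fps_G * fps_F))
     - 7 * (fps_XD fps_F * (fps_G * fps_U)) = 3 * fps_Q"
  using eispoly_fps_eq_0[OF poly_Q_certificate]
  by (simp add: eispoly_fps_simps eispoly_fps_X3 fps_const_eis_val_numeral algebra_simps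
      flip: fps_Q_def fps_G_def fps_U_def fps_F_def del: eis_val.simps)

lemma fps_residue_eq_0:
  "7 * fps_next 3 (fps_next 1 fps_M) - (42 * fps_D + 21 * fps_K) * fps_next 1 fps_M
     + (392 * fps_D - 63 * fps_K) * fps_Q\<^sup>2 * fps_M
     + 85 * fps_const (1 + 3 * omega) * fps_X ^ 3 * fps_G\<^sup>2 * fps_Q ^ 3 = 0"
proof -
  have 1: "fps_const (eis_val (85, 255)) = 85 * fps_const (1 + 3 * omega)"
    by (simp add: numeral_fps_const algebra_simps)
  have 2: "eispoly_fps (poly_next 1 poly_M) = fps_next 1 fps_M"
    using eispoly_fps_next[of 1] by (simp add: fps_M_def)
  have 3: "eispoly_fps (poly_next 3 (poly_next 1 poly_M)) = fps_next 3 (fps_next 1 fps_M)"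
    using eispoly_fps_next[of 3 "poly_next 1 poly_M"] by (simp add: 2)
  show ?thesis
    using eispoly_fps_eq_0[OF poly_residue_certificate]
    by (simp add: poly_residue_def eispoly_fps_simps eispoly_fps_D eispoly_fps_K eispoly_fps_X3
        1 2 3 fps_const_eis_val_numeral power2_eq_square power3_eq_cube algebra_simps
        flip: fps_Q_def fps_G_def fps_M_def del: eis_val.simps)
qed

section \<open>The algebraic solution of the pulled-back equation\<close>

text \<open>The logarithmic derivatives \<open>s / u\<close> and \<open>t / v\<close> add; the form
  is free of division.\<close>

lemma fps_XD_log_mult:
  fixes A B :: "'a :: comm_ring_1 fps"
  assumes "u * fps_XD A = s * A" "v * fps_XD B = t * B"
  shows "(u * v) * fps_XD (A * B) = (s * v + u * t) * (A * B)"
proof -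
  have "(u * v) * fps_XD (A * B) = (u * fps_XD A) * v * B + u * A * (v * fps_XD B)"
    by (simp add: fps_XD_mult algebra_simps)
  thus ?thesis by (simp add: assms algebra_simps)
qed

definition fps_lin :: "complex \<Rightarrow> complex fps" where
  "fps_lin c = 1 - fps_const c * fps_X"

lemma fps_lin_nth_0 [simp]: "fps_nth (fps_lin c) 0 = 1"
  by (simp add: fps_lin_def)

lemma fps_XD_lin: "fps_XD (fps_lin c) = - fps_const c * fps_X"
  by (simp add: fps_lin_def fps_XD_def)

definition fps_lin_powr :: "complex \<Rightarrow> complex \<Rightarrow> complex \<Rightarrow> complex fps" where
  "fps_lin_powr e1 e2 e3 =
     fps_powr (fps_lin 1) e1 * fps_powr (fps_lin omega) e2 * fps_powr (fps_lin (omega\<^sup>2)) e3"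

lemma fps_lin_powr_nth_0 [simp]: "fps_nth (fps_lin_powr e1 e2 e3) 0 = 1"
  by (simp add: fps_lin_powr_def)

lemma fps_const_omega_square: "(fps_const omega)\<^sup>2 = -1 - fps_const omega"
  by (simp add: omega_square flip: fps_const_sub fps_const_neg)

lemma fps_U_eq: "fps_U = 1 - fps_X ^ 3"
  by (simp add: fps_U_def poly_U_def power3_eq_cube flip: fps_const_neg)

lemma fps_U_eq_prod: "fps_U = fps_lin 1 * fps_lin omega * fps_lin (omega\<^sup>2)"
proof -
  have "fps_lin (omega\<^sup>2) = 1 - (fps_const omega)\<^sup>2 * fps_X"
    by (simp add: fps_lin_def)
  thus ?thesis
    unfolding fps_U_eq fps_lin_def fps_const_1_eq_1 using fps_const_omega_square by algebra
qed

text \<open>Each factor contributes \<open>- e c x / (1 - c x)\<close>, and \<open>c^3 = 1\<close>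
  gives \<open>1 / (1 - c x) = (1 + c x + c^2 x^2) / (1 - x^3)\<close>.\<close>

lemma fps_XD_lin_powr:
  "fps_U * fps_XD (fps_lin_powr e1 e2 e3) =
     - (fps_const (e1 + e2 * omega + e3 * omega\<^sup>2) * fps_X
        + fps_const (e1 + e2 * omega\<^sup>2 + e3 * omega) * fps_X\<^sup>2
        + fps_const (e1 + e2 + e3) * fps_X ^ 3) * fps_lin_powr e1 e2 e3"
proof -
  let ?e1 = "fps_const e1" and ?e2 = "fps_const e2" and ?e3 = "fps_const e3" and ?w = "fps_const omega"
  have *: "fps_lin c * fps_XD (fps_powr (fps_lin c) e)
      = (- fps_const e * fps_const c * fps_X) * fps_powr (fps_lin c) e" for c e
    by (subst fps_XD_fps_powr) (simp_all add: fps_XD_lin mult_ac flip: fps_const_neg fps_const_mult)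
  have "fps_U * fps_XD (fps_lin_powr e1 e2 e3) =
     ((- ?e1 * fps_X * fps_lin omega + fps_lin 1 * (- ?e2 * ?w * fps_X)) * fps_lin (omega\<^sup>2)
       + fps_lin 1 * fps_lin omega * (- ?e3 * ?w\<^sup>2 * fps_X)) * fps_lin_powr e1 e2 e3"
    using fps_XD_log_mult[OF fps_XD_log_mult[OF *[of 1 e1] *[of omega e2]] *[of "omega\<^sup>2" e3]]
    by (simp only: fps_U_eq_prod fps_lin_powr_def fps_const_power fps_const_1_eq_1 mult_1_right)
  also have "(- ?e1 * fps_X * fps_lin omega + fps_lin 1 * (- ?e2 * ?w * fps_X)) * fps_lin (omega\<^sup>2)
       + fps_lin 1 * fps_lin omega * (- ?e3 * ?w\<^sup>2 * fps_X) =
     - ((?e1 + ?e2 * ?w + ?e3 * ?w\<^sup>2) * fps_X + (?e1 + ?e2 * ?w\<^sup>2 + ?e3 * ?w) * fps_X\<^sup>2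
        + (?e1 + ?e2 + ?e3) * fps_X ^ 3)"
    unfolding fps_lin_def fps_const_1_eq_1 fps_const_power [symmetric]
    using fps_const_omega_square by algebra
  finally show ?thesis
    by simp
qed

definition fps_F2 :: "complex fps" where "fps_F2 = fps_const (1/49) * fps_F"
definition fps_G2 :: "complex fps" where "fps_G2 = fps_const (1/134456) * fps_G"

lemma fps_FGQU_nth_0 [simp]:
  "fps_nth fps_F 0 = 49" "fps_nth fps_G 0 = 134456" "fps_nth fps_Q 0 = 6588344" "fps_nth fps_U 0 = 1"
  by (simp_all add: fps_F_def poly_F_def fps_G_def poly_G_def fps_Q_def poly_Q_def fps_U_def poly_U_def)

lemma fps_F2_nth_0 [simp]: "fps_nth fps_F2 0 = 1" and fps_G2_nth_0 [simp]: "fps_nth fps_G2 0 = 1"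
  by (simp_all add: fps_F2_def fps_G2_def)

lemma fps_F_eq: "fps_F = 49 * fps_F2" and fps_G_eq: "fps_G = 134456 * fps_G2"
  by (simp_all add: fps_F2_def fps_G2_def numeral_fps_const flip: mult.assoc)

lemma fps_XD_F2_powr:
  "fps_F * fps_XD (fps_powr fps_F2 e) = (fps_const e * fps_XD fps_F) * fps_powr fps_F2 e"
proof -
  have "fps_XD fps_F = 49 * fps_XD fps_F2"
    by (simp add: fps_F_eq numeral_fps_const)
  moreover have "fps_F2 * fps_XD (fps_powr fps_F2 e) = fps_const e * fps_XD fps_F2 * fps_powr fps_F2 e"
    by (rule fps_XD_fps_powr) simp
  ultimately show ?thesis
    unfolding fps_F_eq by (simp add: mult_ac)
qed

text \<open>The cube root of \<open>z / (24 * omega + 8)\<close> that starts with \<open>x\<close>.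
  The power of \<open>1 - x^3\<close> is split into linear factors so that it combines with the
  radicals of the identities.\<close>

definition fps_P :: "complex fps" where
  "fps_P = fps_X * fps_G2 * fps_lin_powr (-1/3) (-1/3) (-1/3) * fps_powr fps_F2 (-7/3)"

text \<open>The reciprocal of \<open>x z' / z = 3 Q / (G U F)\<close>, which turns
  \<open>x d/dx\<close> into \<open>z d/dz\<close>.\<close>

definition fps_r :: "complex fps" where
  "fps_r = fps_const (1/3) * fps_G * fps_U * fps_F * inverse fps_Q"

definition fps_g :: "complex fps" where
  "fps_g = fps_lin_powr (-1/42) (5/42) (17/42) * fps_powr fps_F2 (-1/6)"

lemma fps_r_Q: "3 * fps_r * fps_Q = fps_G * fps_U * fps_F"
proof -
  have "inverse fps_Q * fps_Q = 1"
    by (rule inverse_mult_eq_1) simp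
  hence "3 * fps_r * fps_Q = (3 * fps_const (1/3)) * (fps_G * fps_U * fps_F)"
    unfolding fps_r_def by (simp add: mult_ac)
  thus ?thesis by (simp add: numeral_fps_const)
qed

lemma fps_Q_nz: "fps_Q \<noteq> 0"
  using fps_FGQU_nth_0(3) by force

lemma fps_XD_P: "(fps_G * fps_U * fps_F) * fps_XD fps_P = fps_Q * fps_P"
proof -
  let ?c = "fps_const (-7/3) :: complex fps"
  have XG: "fps_G * fps_XD (fps_X * fps_G2) = (fps_G + fps_XD fps_G) * (fps_X * fps_G2)"
    unfolding fps_G_eq
    by (simp add: fps_XD_mult numeral_fps_const algebra_simps) (simp add: fps_XD_def)
  have "1 + omega + omega\<^sup>2 = 0"
    by (simp add: omega_square)
  \<comment> \<open>For equal exponents the coefficients of \<open>x\<close> and \<open>x^2\<close>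
    are multiples of \<open>1 + omega + omega^2\<close>, so only the \<open>x^3\<close> term
    survives.\<close>
  hence e: "-1/3 + -1/3 * omega + -1/3 * omega\<^sup>2 = 0" "-1/3 + -1/3 * omega\<^sup>2 + -1/3 * omega = 0"
    by algebra+
  have e': "fps_const (-1/3 + -1/3 + -1/3 :: complex) = -1"
    by (simp flip: fps_const_neg)
  have L: "fps_U * fps_XD (fps_lin_powr (-1/3) (-1/3) (-1/3)) =
      fps_X ^ 3 * fps_lin_powr (-1/3) (-1/3) (-1/3)"
    unfolding fps_XD_lin_powr e e' by simp
  have "(fps_G * fps_U * fps_F) * fps_XD fps_P =
     (((fps_G + fps_XD fps_G) * fps_U + fps_G * fps_X ^ 3) * fps_F
       + fps_G * fps_U * (?c * fps_XD fps_F)) * fps_P"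
    unfolding fps_P_def by (intro fps_XD_log_mult XG L fps_XD_F2_powr)
  moreover have "((fps_G + fps_XD fps_G) * fps_U + fps_G * fps_X ^ 3) * fps_F
       + fps_G * fps_U * (?c * fps_XD fps_F) = fps_Q"
  proof -
    have "3 * ?c = -7"
      by (simp add: numeral_fps_const)
    hence "3 * (((fps_G + fps_XD fps_G) * fps_U + fps_G * fps_X ^ 3) * fps_F
       + fps_G * fps_U * (?c * fps_XD fps_F)) = 3 * fps_Q"
      using fps_Q_eq by algebra
    thus ?thesis by (subst (asm) mult_left_cancel) auto
  qed
  ultimately show ?thesis by simp
qed

lemma fps_P_ODE: "fps_r * fps_XD fps_P = fps_const (1/3) * fps_P"
proof -
  have "3 * fps_Q * (fps_r * fps_XD fps_P) = fps_Q * fps_P"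
    using fps_XD_P fps_r_Q by algebra
  also have "\<dots> = 3 * fps_Q * (fps_const (1/3) * fps_P)"
    by (simp add: numeral_fps_const mult_ac)
  finally show ?thesis
    using fps_Q_nz by simp
qed

interpretation pb: euler_pullback fps_r fps_P "24 * omega + 8" "-1/42" "5/42" "17/42"
proof
  show "fps_nth fps_r 0 = 1/3"
    by (simp add: fps_r_def)
  show "fps_nth fps_P 0 = 0"
    by (simp add: fps_P_def)
qed (rule fps_P_ODE)

text \<open>Cubing \<open>fps_P\<close> turns its radicals into the integral powers
  \<open>U^(-1)\<close> and \<open>F2^(-7)\<close>.\<close>

lemma fps_D_z: "fps_D * pb.z = fps_K"
proof -
  let ?l = "\<lambda>c. fps_powr (fps_lin c) (-1/3)"
  have L: "?l c ^ 3 * fps_lin c = 1" for c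
    using fps_powr_power_cancel[of "fps_lin c" 3 "-1/3" 1] by simp
  have F: "fps_powr fps_F2 (-7/3) ^ 3 * fps_F2 ^ 7 = 1"
    by (rule fps_powr_power_cancel) simp_all
  have "fps_U * fps_F2 ^ 7 * fps_P ^ 3 =
     fps_X ^ 3 * fps_G2 ^ 3 * (?l 1 ^ 3 * fps_lin 1) * (?l omega ^ 3 * fps_lin omega)
     * (?l (omega\<^sup>2) ^ 3 * fps_lin (omega\<^sup>2)) * (fps_powr fps_F2 (-7/3) ^ 3 * fps_F2 ^ 7)"
    unfolding fps_P_def fps_lin_powr_def fps_U_eq_prod power_mult_distrib by (simp add: mult_ac)
  hence P3: "fps_U * fps_F2 ^ 7 * fps_P ^ 3 = fps_X ^ 3 * fps_G2 ^ 3"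
    by (simp only: L F mult_1_right)
  have "fps_D * pb.z = 448 * 49 ^ 7 * fps_const (24 * omega + 8) * (fps_U * fps_F2 ^ 7 * fps_P ^ 3)"
    unfolding fps_D_def pb.z_def fps_F_eq power_mult_distrib by (simp only: mult_ac)
  \<comment> \<open>Both sides are \<open>2^9 * 7^15 * (1 + 3 * omega)\<close>, since
    \<open>448 = 2^6 * 7\<close> and \<open>134456 = 2^3 * 7^5\<close>.\<close>
  also have "448 * 49 ^ 7 * fps_const (24 * omega + 8) = 134456 ^ 3 * fps_const (1 + 3 * omega)"
    by (simp add: numeral_fps_const algebra_simps)
  finally show ?thesis
    unfolding P3 fps_K_def fps_G_eq power_mult_distrib by (simp only: mult_ac)
qed

lemma fps_XD_g: "14 * (fps_U * fps_F) * fps_XD fps_g = fps_M * fps_g"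
proof -
  let ?w = "fps_const omega"
  let ?A = "- (fps_const (-1/42 + 5/42 * omega + 17/42 * omega\<^sup>2) * fps_X
        + fps_const (-1/42 + 5/42 * omega\<^sup>2 + 17/42 * omega) * fps_X\<^sup>2
        + fps_const (-1/42 + 5/42 + 17/42) * fps_X ^ 3) * fps_F
       + fps_U * (fps_const (-1/6) * fps_XD fps_F)"
  have "(fps_U * fps_F) * fps_XD fps_g = ?A * fps_g"
    unfolding fps_g_def by (intro fps_XD_log_mult fps_XD_lin_powr fps_XD_F2_powr)
  hence "14 * (fps_U * fps_F) * fps_XD fps_g = (14 * ?A) * fps_g"
    by (simp only: mult.assoc)
  also have "14 * ?A = fps_M"
  proof -
    have c: "42 * fps_const (-1/42 + 5/42 * omega + 17/42 * omega\<^sup>2) = -18 - 12 * ?w"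
      "42 * fps_const (-1/42 + 5/42 * omega\<^sup>2 + 17/42 * omega) = -6 + 12 * ?w"
      "42 * fps_const (-1/42 + 5/42 + 17/42 :: complex) = 21"
      "6 * fps_const (-1/6 :: complex) = -1"
      by (simp_all add: numeral_fps_const omega_square field_simps)
    have F: "fps_F = 49 + (39 * ?w - 16) * fps_X ^ 3"
      by (simp add: fps_F_def poly_F_def power3_eq_cube numeral_fps_const algebra_simps)
    have XF: "fps_XD fps_F = 3 * (39 * ?w - 16) * fps_X ^ 3"
      unfolding F by (simp add: fps_XD_def fps_deriv_power' power3_eq_cube power2_eq_square algebra_simps)
    have M: "fps_M = (294 + 196 * ?w) * fps_X + (98 - 196 * ?w) * fps_X ^ 2 + (-231 - 273 * ?w) * fps_X ^ 3
       + (-252 + 14 * ?w) * fps_X ^ 4 + (124 + 298 * ?w) * fps_X ^ 5"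
      by (simp add: fps_M_def poly_M_def numeral_fps_const eval_nat_numeral algebra_simps)
    \<comment> \<open>The factor 42 clears the denominators of the exponents.\<close>
    have "42 * (14 * ?A) =
      14 * (- ((-18 - 12 * ?w) * fps_X + (-6 + 12 * ?w) * fps_X\<^sup>2 + 21 * fps_X ^ 3) * fps_F
       - 7 * fps_U * fps_XD fps_F)"
      unfolding c[symmetric] using c(4) by algebra
    also have "\<dots> = 42 * fps_M"
      \<comment> \<open>\<open>XF\<close> must be used first, because unfolding \<open>F\<close>
        would destroy its left-hand side.\<close>
      unfolding XF unfolding F M fps_U_eq using fps_const_omega_square by algebra
    finally show ?thesis by (subst (asm) mult_left_cancel) auto
  qed
  finally show ?thesis .
qed

lemma fps_XD_power: "A * fps_XD (A ^ j) = of_nat j * A ^ j * fps_XD (A :: 'a :: comm_ring_1 fps)"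
proof (induction j)
  case (Suc j)
  have "A * fps_XD (A ^ Suc j) = A ^ Suc j * fps_XD A + A * (A * fps_XD (A ^ j))"
    by (simp add: fps_XD_mult algebra_simps)
  thus ?case unfolding Suc.IH by (simp add: algebra_simps)
qed (simp add: fps_XD_def)

text \<open>Differentiating the assumption needs two more powers of \<open>Q\<close>: one turns
  \<open>3 * fps_r * fps_Q\<close> into \<open>G U F\<close>, the other clears the derivative of
  \<open>Q^j\<close>. The logarithmic derivative of \<open>g\<close> then restores the shape of the
  right-hand side.\<close>

lemma fps_next_step:
  assumes "fps_Q ^ j * Y = fps_G * k * fps_g"
  shows "fps_Q ^ (j + 2) * (42 * (fps_r * fps_XD Y)) = fps_G * fps_next j k * fps_g"
proof -
  define q and J :: "complex fps" where "q = fps_Q ^ j" and "J = of_nat j"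
  have qY: "q * Y = fps_G * k * fps_g"
    using assms by (simp add: q_def)
  have Xq: "fps_Q * fps_XD q = J * q * fps_XD fps_Q"
    unfolding q_def J_def by (rule fps_XD_power)
  have "fps_XD q * Y + q * fps_XD Y = fps_XD (fps_G * k) * fps_g + fps_G * k * fps_XD fps_g"
    using qY by (metis fps_XD_mult)
  hence "q * fps_Q\<^sup>2 * (42 * (fps_r * fps_XD Y)) =
     14 * fps_Q * (3 * fps_r * fps_Q) * (fps_XD (fps_G * k) * fps_g + fps_G * k * fps_XD fps_g)
     - 14 * (3 * fps_r * fps_Q) * (fps_Q * fps_XD q) * Y"
    by algebra
  also have "\<dots> = 14 * fps_Q * (fps_G * fps_U * fps_F) * fps_XD (fps_G * k) * fps_g
     + fps_Q * fps_G * fps_G * k * (14 * (fps_U * fps_F) * fps_XD fps_g)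
     - 14 * (fps_G * fps_U * fps_F) * (J * fps_XD fps_Q) * (q * Y)"
    unfolding fps_r_Q Xq by algebra
  also have "\<dots> = fps_G * fps_next j k * fps_g"
    unfolding fps_XD_g qY fps_next_def J_def [symmetric] by algebra
  finally show ?thesis unfolding q_def power_add .
qed

lemma hyp_op_g: "pb.hyp_op fps_g = 0"
proof -
  define T1 T2 T3 where "T1 = 42 * (fps_r * fps_XD fps_g)"
    and "T2 = 42 * (fps_r * fps_XD T1)" and "T3 = 42 * (fps_r * fps_XD T2)"
  let ?k2 = "fps_next 1 fps_M" and ?C = "fps_const (1 + 3 * omega)"
  have Q1: "fps_Q * T1 = fps_G * fps_M * fps_g"
    unfolding T1_def using fps_r_Q fps_XD_g by algebra
  have Q2: "fps_Q ^ 3 * T2 = fps_G * ?k2 * fps_g"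
    using fps_next_step[of 1 T1 fps_M] Q1 by (simp add: T2_def power3_eq_cube mult.assoc)
  have Q3: "fps_Q ^ 5 * T3 = fps_G * fps_next 3 ?k2 * fps_g"
    using fps_next_step[of 3 T2 ?k2] Q2 by (simp add: T3_def)
  have XD: "fps_XD (42 * D) = 42 * fps_XD D" for D :: "complex fps"
    by (simp add: numeral_fps_const)
  define D1 D2 D3 where "D1 = fps_r * fps_XD fps_g" and "D2 = fps_r * fps_XD D1" and "D3 = fps_r * fps_XD D2"
  have T1: "T1 = 42 * D1" by (simp add: T1_def D1_def)
  have "T2 = 42 * 42 * D2" unfolding T2_def T1 XD by (simp add: D2_def)
  hence T2: "T2 = 42 * (42 * D2)" by simp
  have T3: "T3 = 42 * (42 * (42 * D3))" unfolding T3_def T2 XD by (simp add: D3_def)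
  have hyp: "pb.hyp_op fps_g = D3 + fps_const (0 + -1/3 + -2/3) * D2
        + fps_const (0 * (-1/3) + 0 * (-2/3) + -1/3 * (-2/3)) * D1 + fps_const (0 * (-1/3) * (-2/3)) * fps_g
      - pb.z * (D3 + fps_const (-1/42 + 5/42 + 17/42) * D2
        + fps_const (-1/42 * (5/42) + -1/42 * (17/42) + 5/42 * (17/42)) * D1
        + fps_const (-1/42 * (5/42) * (17/42)) * fps_g)"
    unfolding pb.hyp_op_def pb.theta_theta_theta D1_def D2_def D3_def by (rule refl)
  have cs: "fps_const (0 + -1/3 + -2/3 :: complex) = -1"
    "9 * fps_const (0 * (-1/3) + 0 * (-2/3) + -1/3 * (-2/3) :: complex) = 2"
    "fps_const (0 * (-1/3) * (-2/3) :: complex) = 0"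
    "2 * fps_const (-1/42 + 5/42 + 17/42 :: complex) = 1"
    "28 * fps_const (-1/42 * (5/42) + -1/42 * (17/42) + 5/42 * (17/42) :: complex) = 1"
    "74088 * fps_const (-1/42 * (5/42) * (17/42) :: complex) = -85"
    by (simp_all add: numeral_fps_const flip: fps_const_neg)
  \<comment> \<open>\<open>74088 = 42^3\<close>; with \<open>42 \<theta>\<close> in place of
    \<open>\<theta>\<close> all constants become integers.\<close>
  have "74088 * pb.hyp_op fps_g =
      (T3 - 42 * T2 + 392 * T1) - pb.z * (T3 + 21 * T2 + 63 * T1 - 85 * fps_g)"
    unfolding hyp T1 T2 T3 using cs by algebra
  also have "\<dots> = 0"
  proof -
    \<comment> \<open>Multiplying by \<open>D Q^5\<close> clears all denominators; the factor is
      nonzero and is cancelled at the end.\<close>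
    have "fps_D * fps_Q ^ 5 * ((T3 - 42 * T2 + 392 * T1) - pb.z * (T3 + 21 * T2 + 63 * T1 - 85 * fps_g)) =
      fps_Q ^ 5 * (fps_D * (T3 - 42 * T2 + 392 * T1) - (fps_D * pb.z) * (T3 + 21 * T2 + 63 * T1 - 85 * fps_g))"
      by algebra
    also have "\<dots> = (fps_D - fps_K) * (fps_Q ^ 5 * T3)
       - (42 * fps_D + 21 * fps_K) * fps_Q\<^sup>2 * (fps_Q ^ 3 * T2)
       + (392 * fps_D - 63 * fps_K) * fps_Q ^ 4 * (fps_Q * T1) + 85 * fps_K * fps_Q ^ 5 * fps_g"
      unfolding fps_D_z by algebra
    \<comment> \<open>\<open>D - K = 7 Q^2\<close> supplies the power of \<open>Q\<close> that the
      leading term lacks, so \<open>G Q^2 g\<close> factors out and the certified residue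
      remains.\<close>
    also have "\<dots> = fps_G * fps_Q\<^sup>2 * fps_g *
       (7 * fps_next 3 ?k2 - (42 * fps_D + 21 * fps_K) * ?k2
         + (392 * fps_D - 63 * fps_K) * fps_Q\<^sup>2 * fps_M
         + 85 * ?C * fps_X ^ 3 * fps_G\<^sup>2 * fps_Q ^ 3)"
    proof -
      have "fps_D - fps_K = 7 * fps_Q\<^sup>2" by (simp add: fps_D_eq)
      moreover have "fps_K = ?C * fps_X ^ 3 * fps_G ^ 3" by (rule fps_K_def)
      ultimately show ?thesis unfolding Q1 Q2 Q3 by algebra
    qed
    finally have "fps_D * fps_Q ^ 5 * ((T3 - 42 * T2 + 392 * T1) - pb.z * (T3 + 21 * T2 + 63 * T1 - 85 * fps_g)) = 0"
      unfolding fps_residue_eq_0 by simp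
    moreover have "fps_nth fps_D 0 \<noteq> 0"
      by (simp add: fps_D_def)
    hence "fps_D \<noteq> 0" by force
    ultimately show ?thesis using fps_Q_nz by simp
  qed
  finally show ?thesis by simp
qed

section \<open>Initial coefficients and the decomposition of \<open>g\<close>\<close>

lemma fps_mult_nth_2: "fps_nth (A * B) 2 = fps_nth A 0 * fps_nth B 2 + fps_nth A 1 * fps_nth B 1 + fps_nth A 2 * fps_nth B 0"
  for A B :: "'a :: comm_ring_1 fps"
  by (simp add: fps_mult_nth eval_nat_numeral)

lemma eispoly_fps_nth:
  "fps_nth (eispoly_fps p) n = (if n < length p then eis_val (p ! n) else 0)"
  by (induction p arbitrary: n) (auto simp: nth_Cons split: nat.splits)

lemma fps_P_nth: "fps_nth fps_P 1 = 1" "fps_nth fps_P 2 = 0"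
proof -
  show 1: "fps_nth fps_P 1 = 1"
    by (simp add: fps_P_def fps_mult_nth_1 mult.assoc)
  have "fps_nth (fps_G * fps_U * fps_F) 1 = 0" "fps_nth fps_Q 1 = 0"
    by (simp_all add: fps_mult_nth_1 eispoly_fps_nth fps_G_def poly_G_def fps_U_def poly_U_def
        fps_F_def poly_F_def fps_Q_def poly_Q_def)
  \<comment> \<open>\<open>G U F\<close> and \<open>Q\<close> have the same constant term and no
    linear term, so index 2 yields \<open>2 p = p\<close> for the wanted coefficient
    \<open>p\<close>.\<close>
  moreover have "fps_nth ((fps_G * fps_U * fps_F) * fps_XD fps_P) 2 = fps_nth (fps_Q * fps_P) 2"
    by (simp add: fps_XD_P)
  ultimately show "fps_nth fps_P 2 = 0"
    unfolding fps_mult_nth_2 by (simp add: pb.P_nth_0)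
qed

text \<open>Read off from the first-order equation \<open>fps_XD_g\<close>. These coefficients are
  the origin of the prefactors in the second and third identity.\<close>

lemma fps_g_nth:
  "fps_nth fps_g 0 = 1" "fps_nth fps_g 1 = 1 / (1 - 2 * omega)" "fps_nth fps_g 2 = 3 / (21 + 7 * omega)"
proof -
  show 0: "fps_nth fps_g 0 = 1"
    by (simp add: fps_g_def)
  have UF: "fps_nth (14 * (fps_U * fps_F)) 0 = 686" "fps_nth (14 * (fps_U * fps_F)) 1 = 0"
    by (simp_all add: numeral_fps_const fps_mult_nth_1 eispoly_fps_nth fps_U_def poly_U_def fps_F_def poly_F_def)
  have M: "fps_nth fps_M 0 = 0" "fps_nth fps_M 1 = 294 + 196 * omega" "fps_nth fps_M 2 = 98 - 196 * omega"
    by (simp_all add: fps_M_def eispoly_fps_nth poly_M_def)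
  \<comment> \<open>The second factor is the complex conjugate of the first; a nonzero norm shows
    that \<open>1 - 2 * omega\<close> is nonzero.\<close>
  have "(1 - 2 * omega) * (3 + 2 * omega) = 7"
    using omega_square by algebra
  hence nz: "1 - 2 * omega \<noteq> 0" by auto
  have "(21 + 7 * omega) * (2 - omega) = 49"
    using omega_square by algebra
  hence nz2: "21 + 7 * omega \<noteq> 0" by auto
  have "fps_nth (14 * (fps_U * fps_F) * fps_XD fps_g) 1 = fps_nth (fps_M * fps_g) 1"
    by (simp only: fps_XD_g)
  hence g1: "686 * fps_nth fps_g 1 = 294 + 196 * omega"
    by (simp add: fps_mult_nth_1 0 UF M del: One_nat_def)
  have "(1 - 2 * omega) * fps_nth fps_g 1 = 1"
    using g1 omega_square by algebra
  thus "fps_nth fps_g 1 = 1 / (1 - 2 * omega)"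
    using nz by (simp add: eq_divide_eq mult.commute)
  have "fps_nth (14 * (fps_U * fps_F) * fps_XD fps_g) 2 = fps_nth (fps_M * fps_g) 2"
    by (simp only: fps_XD_g)
  hence g2: "1372 * fps_nth fps_g 2 = (294 + 196 * omega) * fps_nth fps_g 1 + (98 - 196 * omega)"
    unfolding fps_mult_nth_2 UF M 0 by simp
  have "1372 * fps_nth fps_g 2 = (42 + 28 * omega) * (7 * fps_nth fps_g 1) + (98 - 196 * omega)"
    unfolding g2 by (simp add: algebra_simps)
  also have "7 * fps_nth fps_g 1 = 3 + 2 * omega"
    using g1 by algebra
  finally have "1372 * fps_nth fps_g 2 = 168 - 84 * omega"
    using omega_square by algebra
  hence "49 * fps_nth fps_g 2 = 6 - 3 * omega"
    by algebra
  hence "(21 + 7 * omega) * fps_nth fps_g 2 = 3"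
    using omega_square by algebra
  thus "fps_nth fps_g 2 = 3 / (21 + 7 * omega)"
    using nz2 by (simp add: eq_divide_eq mult.commute)
qed

text \<open>The upper parameters of \<open>H1\<close> and \<open>H2\<close> are those of
  \<open>H0\<close> raised by 1/3 and 2/3, the shifts caused by the factors \<open>P\<close> and
  \<open>P^2\<close>.\<close>

abbreviation "H0 \<equiv> fps_hyp3F2 (-1/42) (5/42) (17/42) (1/3) (2/3)"
abbreviation "H1 \<equiv> fps_hyp3F2 (13/42) (19/42) (31/42) (2/3) (4/3)"
abbreviation "H2 \<equiv> fps_hyp3F2 (9/14) (11/14) (15/14) (4/3) (5/3)"

lemma of_real_add_of_nat_nz:
  assumes "q > 0" shows "complex_of_real q + of_nat n \<noteq> 0"
proof -
  have "q + real n > 0" using assms by simp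
  thus ?thesis by (metis less_irrefl of_real_add of_real_eq_0_iff of_real_of_nat_eq)
qed

lemma divide_numeral_add_of_nat_nz [simp]: "(numeral a / numeral b + of_nat n :: complex) \<noteq> 0"
  "(1 / numeral b + of_nat n :: complex) \<noteq> 0"
  using of_real_add_of_nat_nz[of "numeral a / numeral b" n] of_real_add_of_nat_nz[of "1 / numeral b" n]
  by simp_all

text \<open>The only negative parameter, out of reach of the positivity argument.\<close>

lemma minus_1_42_add_of_nat_nz [simp]: "(-1/42 + of_nat n :: complex) \<noteq> 0"
proof
  assume "(-1/42 + of_nat n :: complex) = 0"
  hence "of_nat (42 * n) = (of_nat 1 :: complex)" by (simp add: mult.commute)
  hence "42 * n = 1" unfolding of_nat_eq_iff .
  thus False by presburger
qed

lemma fps_XDp_left_commute: "fps_XDp a (fps_XDp b D) = fps_XDp b (fps_XDp (a :: 'a :: comm_ring_1) D)"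
  by (rule fps_ext) (simp add: mult_ac)

lemma fps_XDp_fps_XD_commute: "fps_XDp a (fps_XD D) = fps_XD (fps_XDp (a :: 'a :: comm_ring_1) D)"
  by (rule fps_ext) (simp add: mult_ac)

text \<open>For \<open>k = 0, 1, 2\<close> a different one of the three shifts becomes 0; the
  operators \<open>fps_XDp\<close> commute, so it can be moved to the front as in
  \<open>fps_hyp3F2_ODE\<close>.\<close>

lemma hyp_op_H:
  "pb.hyp_op (H0 oo pb.z) = 0" "pb.hyp_op (fps_P * (H1 oo pb.z)) = 0" "pb.hyp_op (fps_P ^ 2 * (H2 oo pb.z)) = 0"
proof -
  have "pb.hyp_op (fps_P ^ 0 * (H0 oo pb.z)) = 0"
    using fps_hyp3F2_ODE[of "1/3" "2/3" "-1/42" "5/42" "17/42"]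
    by (intro pb.hyp_op_P_power_compose) (simp add: fps_XDp_left_commute[of "-(2/3)" "-(1/3)"])
  thus "pb.hyp_op (H0 oo pb.z) = 0" by simp
  have "pb.hyp_op (fps_P ^ 1 * (H1 oo pb.z)) = 0"
    using fps_hyp3F2_ODE[of "2/3" "4/3" "13/42" "19/42" "31/42"]
    by (intro pb.hyp_op_P_power_compose)
      (simp add: fps_XDp_fps_XD_commute fps_XDp_left_commute[of "1/3" "-(1/3)"])
  thus "pb.hyp_op (fps_P * (H1 oo pb.z)) = 0" by simp
  show "pb.hyp_op (fps_P ^ 2 * (H2 oo pb.z)) = 0"
    using fps_hyp3F2_ODE[of "4/3" "5/3" "9/14" "11/14" "15/14"]
    by (intro pb.hyp_op_P_power_compose)
      (simp add: fps_XDp_fps_XD_commute fps_XDp_left_commute[of "2/3" "1/3"])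
qed

text \<open>Both sides are annihilated by \<open>hyp_op\<close>. Up to order 2 the three series
  start like 1, \<open>x\<close>, \<open>x^2\<close>, so the weights are the coefficients of
  \<open>g\<close>.\<close>

lemma fps_g_eq:
  "fps_g = (H0 oo pb.z) + fps_const (1 / (1 - 2 * omega)) * (fps_P * (H1 oo pb.z))
     + fps_const (3 / (21 + 7 * omega)) * (fps_P ^ 2 * (H2 oo pb.z))" (is "_ = ?R")
proof -
  define R where "R = ?R"
  define D where "D = fps_g + fps_const (-1) * R"
  have "pb.hyp_op D = 0"
    unfolding D_def R_def pb.hyp_op_add pb.hyp_op_cmult hyp_op_H hyp_op_g by simp
  moreover have "fps_nth D 0 = 0" "fps_nth D 1 = 0" "fps_nth D 2 = 0"
  proof -
    have z: "fps_nth (fps_hyp3F2 a b c d e oo pb.z) 1 = 0" "fps_nth (fps_hyp3F2 a b c d e oo pb.z) 2 = 0"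
      for a b c d e
      by (simp_all add: pb.compose_z_nth)
    have P2: "fps_nth (fps_P\<^sup>2) 0 = 0" "fps_nth (fps_P\<^sup>2) 1 = 0" "fps_nth (fps_P\<^sup>2) 2 = 1"
      unfolding power2_eq_square fps_mult_nth_0 fps_mult_nth_1 fps_mult_nth_2 pb.P_nth_0 fps_P_nth
      by simp_all
    show "fps_nth D 0 = 0" "fps_nth D 1 = 0" "fps_nth D 2 = 0"
      unfolding D_def R_def fps_add_nth fps_mult_left_const_nth fps_mult_nth_0 fps_mult_nth_1
        fps_mult_nth_2 z P2 pb.P_nth_0 fps_P_nth fps_g_nth fps_compose_nth_0 fps_hyp3F2_nth_0
      by simp_all
  qed
  ultimately have "D = 0"
    by (rule pb.hyp_op_eq_0_imp_eq_0)
  moreover have "D = fps_g - R"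
    unfolding D_def by (rule fps_ext) simp
  ultimately show ?thesis by (simp add: R_def)
qed

section \<open>From power series to functions\<close>

lemma mu_eq:
  assumes "x \<noteq> 1"
  shows "mu x = - omega * (1 - omega * x) / (1 - x)"
proof -
  have "omega \<noteq> 0"
    by (simp add: omega_def)
  moreover have "x + omega + 1 = omega * (- omega * (1 - omega * x))"
    using omega_square by algebra
  ultimately show ?thesis
    using assms by (simp add: mu_def)
qed

text \<open>Homogenisation: with \<open>s = n / d\<close>, every polynomial in \<open>s\<close>
  times a power of \<open>d\<close> is a polynomial in the linear forms \<open>n\<close> and
  \<open>d\<close>, hence in \<open>x\<close>.\<close>

lemma Phi3star_eq:
  assumes "x \<noteq> 1"
  shows "Phi3star x = (24 * omega + 8) * x ^ 3 * (G2 x) ^ 3 / ((1 - x ^ 3) * (F2 x) ^ 7)"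
proof -
  define s where "s = mu x"
  define d where "d = 1 - x"
  define n where "n = s * d"
  have d: "d \<noteq> 0" and sd: "n = - omega * (1 - omega * x)"
    using assms by (simp_all add: s_def d_def n_def mu_eq)
  have n: "n = - omega - (1 + omega) * x"
    unfolding sd using omega_square by algebra
  have n2: "n\<^sup>2 = (-1 - omega) - 2 * x + omega * x\<^sup>2"
    unfolding n using omega_square by algebra
  \<comment> \<open>The third \<open>d\<close> stands for the point at infinity: 0, 1 and infinity
    are the images under \<open>mu\<close> of the three cube roots of unity.\<close>
  have s': "s * (s - 1) * d ^ 3 = - (1 - x ^ 3)"
  proof -
    have "s * (s - 1) * d ^ 3 = (n\<^sup>2 - n * d) * d" unfolding n_def by algebra
    also have "\<dots> = - (1 - x ^ 3)" unfolding n2 n d_def using omega_square by algebra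
    finally show ?thesis .
  qed
  have G0: "G0 s * d\<^sup>2 = - 3 * x"
  proof -
    have "G0 s * d\<^sup>2 = d\<^sup>2 - n * d + n\<^sup>2" unfolding n_def G0_def by algebra
    also have "\<dots> = - 3 * x" unfolding n2 n d_def using omega_square by algebra
    finally show ?thesis .
  qed
  \<comment> \<open>The constant is the value at \<open>x = 0\<close>, that is
    \<open>F1 (mu 0)\<close>; likewise \<open>496 - 696 * omega\<close> below is
    \<open>G1 (mu 0)\<close>.\<close>
  have F1: "F1 s * d ^ 3 = (8 + 3 * omega) * F2 x"
  proof -
    have "F1 s * d ^ 3 = d ^ 3 + 5 * n * d\<^sup>2 - 8 * n\<^sup>2 * d + n * n\<^sup>2"
      unfolding n_def F1_def by algebra
    also have "\<dots> = 8 + 3 * omega + (-5 + 3 * omega) * x ^ 3"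
      unfolding n2 n d_def using omega_square by algebra
    also have "\<dots> = (8 + 3 * omega) * F2 x"
    proof -
      have "49 * F2 x = 49 + (39 * omega - 16) * x ^ 3"
        by (simp add: F2_def field_simps)
      hence "49 * (8 + 3 * omega + (-5 + 3 * omega) * x ^ 3) = 49 * ((8 + 3 * omega) * F2 x)"
        using omega_square by algebra
      thus ?thesis by (subst (asm) mult_left_cancel) auto
    qed
    finally show ?thesis .
  qed
  have G1: "G1 s * d ^ 6 = (496 - 696 * omega) * G2 x"
  proof -
    have "G1 s * d ^ 6 = d ^ 6 - 235 * n * d ^ 5 + 1430 * n\<^sup>2 * d ^ 4 - 1695 * (n * n\<^sup>2) * d ^ 3
       + 270 * (n\<^sup>2)\<^sup>2 * d\<^sup>2 + 229 * (n * (n\<^sup>2)\<^sup>2) * d + (n\<^sup>2) ^ 3"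
      unfolding n_def G1_def by algebra
    also have "\<dots> = 496 - 696 * omega - 1715 * x ^ 3 + (1192 + 696 * omega) * x ^ 6"
      unfolding n2 n d_def using omega_square by algebra
    also have "\<dots> = (496 - 696 * omega) * G2 x"
    proof -
      have "134456 * G2 x = 134456 - (255535 + 149205 * omega) * x ^ 3 + (117056 + 146856 * omega) * x ^ 6"
        by (simp add: G2_def field_simps)
      hence "134456 * (496 - 696 * omega - 1715 * x ^ 3 + (1192 + 696 * omega) * x ^ 6)
          = 134456 * ((496 - 696 * omega) * G2 x)"
        using omega_square by algebra
      thus ?thesis by (subst (asm) mult_left_cancel) auto
    qed
    finally show ?thesis .
  qed
  have "Phi3star x = (G0 s) ^ 3 * (G1 s) ^ 3 / (1728 * (s * (s - 1)) * (F1 s) ^ 7)"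
    by (simp add: Phi3star_def Phi3_def s_def mult.assoc)
  \<comment> \<open>The exponent is \<open>3 * 2 + 3 * 6\<close> in the numerator and
    \<open>3 + 7 * 3\<close> in the denominator.\<close>
  also have "\<dots> = ((G0 s) ^ 3 * (G1 s) ^ 3) * d ^ 24 / ((1728 * (s * (s - 1)) * (F1 s) ^ 7) * d ^ 24)"
    using d by simp
  also have "((G0 s) ^ 3 * (G1 s) ^ 3) * d ^ 24 = (G0 s * d\<^sup>2) ^ 3 * (G1 s * d ^ 6) ^ 3"
    by algebra
  also have "(1728 * (s * (s - 1)) * (F1 s) ^ 7) * d ^ 24 = 1728 * (s * (s - 1) * d ^ 3) * (F1 s * d ^ 3) ^ 7"
    by algebra
  also have "(G0 s * d\<^sup>2) ^ 3 * (G1 s * d ^ 6) ^ 3 =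
      (- 27 * (496 - 696 * omega) ^ 3) * (x ^ 3 * (G2 x) ^ 3)"
    unfolding G0 G1 by algebra
  also have "- 27 * (496 - 696 * omega) ^ 3 = (- 1728 * (8 + 3 * omega) ^ 7) * (24 * omega + 8)"
    using omega_square by algebra
  also have "1728 * (s * (s - 1) * d ^ 3) * (F1 s * d ^ 3) ^ 7 =
      (- 1728 * (8 + 3 * omega) ^ 7) * ((1 - x ^ 3) * (F2 x) ^ 7)"
    unfolding s' F1 by algebra
  also have "(- 1728 * (8 + 3 * omega) ^ 7) * (24 * omega + 8) * (x ^ 3 * (G2 x) ^ 3)
      / ((- 1728 * (8 + 3 * omega) ^ 7) * ((1 - x ^ 3) * (F2 x) ^ 7)) =
      (24 * omega + 8) * (x ^ 3 * (G2 x) ^ 3) / ((1 - x ^ 3) * (F2 x) ^ 7)"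
  proof -
    have "(8 + 3 * omega) * (5 - 3 * omega) = 49"
      using omega_square by algebra
    hence "8 + 3 * omega \<noteq> 0" by auto
    thus ?thesis by (simp add: mult.assoc)
  qed
  finally show ?thesis by (simp add: mult.assoc)
qed

section \<open>Expansions of the functions at 0\<close>

lemma F2_expansion: "F2 has_fps_expansion fps_F2"
proof -
  have "(\<lambda>x. 1 + (39 * omega - 16) / 49 * x ^ 3) has_fps_expansion
      1 + fps_const ((39 * omega - 16) / 49) * fps_X ^ 3"
    by (intro fps_expansion_intros)
  also have "1 + fps_const ((39 * omega - 16) / 49) * fps_X ^ 3 = fps_F2"
    by (rule fps_ext)
      (simp add: fps_F2_def fps_F_def poly_F_def eispoly_fps_nth nth_Cons numeral_eq_Suc field_simps
         fps_X_power_nth split: nat.splits)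
  finally show ?thesis by (simp add: F2_def [abs_def])
qed

lemma G2_expansion: "G2 has_fps_expansion fps_G2"
proof -
  have "(\<lambda>x. 1 - (435 * omega + 745) / 392 * x ^ 3 + (18357 * omega + 14632) / 16807 * x ^ 6) has_fps_expansion
      1 - fps_const ((435 * omega + 745) / 392) * fps_X ^ 3 + fps_const ((18357 * omega + 14632) / 16807) * fps_X ^ 6"
    by (intro fps_expansion_intros)
  also have "1 - fps_const ((435 * omega + 745) / 392) * fps_X ^ 3
      + fps_const ((18357 * omega + 14632) / 16807) * fps_X ^ 6 = fps_G2"
    by (rule fps_ext)
      (simp add: fps_G2_def fps_G_def poly_G_def eispoly_fps_nth nth_Cons numeral_eq_Suc field_simps
         fps_X_power_nth split: nat.splits)
  finally show ?thesis by (simp add: G2_def [abs_def])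
qed

lemma lin_expansion: "(\<lambda>x. 1 - c * x) has_fps_expansion fps_lin c"
  unfolding fps_lin_def by (intro fps_expansion_intros)

lemma Phi3star_expansion: "Phi3star has_fps_expansion pb.z"
proof -
  let ?f = "\<lambda>x. (24 * omega + 8) * x ^ 3 * (G2 x) ^ 3 / ((1 - x ^ 3) * (F2 x) ^ 7)"
  let ?K = "fps_const (24 * omega + 8) * fps_X ^ 3 * fps_G2 ^ 3" and ?D = "(1 - fps_X ^ 3) * fps_F2 ^ 7"
  have D0: "fps_nth ?D 0 = 1"
    by (simp add: fps_power_zeroth_eq_one)
  have "?f has_fps_expansion ?K / ?D"
    by (intro fps_expansion_intros F2_expansion G2_expansion) (use D0 in simp)
  also have "?K / ?D = pb.z"
  proof -
    have "448 * 49 ^ 7 * fps_const (24 * omega + 8) = 134456 ^ 3 * fps_const (1 + 3 * omega)"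
      by (simp add: numeral_fps_const algebra_simps)
    hence "(448 * 49 ^ 7) * (?D * pb.z) = (448 * 49 ^ 7) * ?K"
      using fps_D_z unfolding fps_D_def fps_K_def fps_F_eq fps_G_eq fps_U_eq by algebra
    hence "?K = pb.z * ?D"
      by (subst (asm) mult_left_cancel) (auto simp: mult.commute)
    thus ?thesis using D0 by (metis fps_divide_times_eq nonzero_mult_div_cancel_right zero_neq_one fps_zero_nth)
  qed
  finally have f: "?f has_fps_expansion pb.z" .
  have "eventually (\<lambda>x. ?f x = Phi3star x) (nhds 0)"
  proof -
    have "eventually (\<lambda>x::complex. x \<in> - {1}) (nhds 0)"
      by (rule eventually_nhds_in_open) auto
    thus ?thesis by eventually_elim (simp add: Phi3star_eq)
  qed
  from has_fps_expansion_cong[OF this refl] f show ?thesis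
    by (rule iffD1)
qed

definition radical :: "complex \<Rightarrow> complex \<Rightarrow> complex \<Rightarrow> complex \<Rightarrow> complex" where
  "radical a b c x = (1 - x) powr a * (1 - omega * x) powr b * (1 - omega\<^sup>2 * x) powr c"

text \<open>The analytic function expanded by \<open>fps_P\<close>.\<close>

definition uniformizer :: "complex \<Rightarrow> complex" where
  "uniformizer x = x * G2 x * radical (-1/3) (-1/3) (-1/3) x * F2 x powr (-7/3)"

lemma radical_expansion: "radical a b c has_fps_expansion fps_lin_powr a b c"
proof -
  have "(\<lambda>x. (1 - 1 * x) powr a * (1 - omega * x) powr b * (1 - omega\<^sup>2 * x) powr c)
      has_fps_expansion fps_lin_powr a b c"
    unfolding fps_lin_powr_def
    by (intro has_fps_expansion_mult has_fps_expansion_fps_powr lin_expansion fps_lin_nth_0)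
  thus ?thesis by (simp add: radical_def [abs_def])
qed

lemma uniformizer_expansion: "uniformizer has_fps_expansion fps_P"
  unfolding uniformizer_def [abs_def] fps_P_def
  by (intro has_fps_expansion_mult has_fps_expansion_fps_X G2_expansion radical_expansion
      has_fps_expansion_fps_powr F2_expansion fps_F2_nth_0)

section \<open>Rotation by \<open>omega\<close> and the three identities\<close>

lemma radical_mult: "radical a b c x * radical a' b' c' x = radical (a + a') (b + b') (c + c') x"
  by (simp add: radical_def powr_add mult_ac)

lemma F2_omega: "F2 (omega * x) = F2 x" and G2_omega: "G2 (omega * x) = G2 x"
proof -
  have "omega ^ 6 = (omega ^ 3)\<^sup>2" by simp
  thus "F2 (omega * x) = F2 x" "G2 (omega * x) = G2 x"
    by (simp_all add: F2_def G2_def power_mult_distrib omega_cube)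
qed

lemma Phi3star_omega: "x \<noteq> 1 \<Longrightarrow> omega * x \<noteq> 1 \<Longrightarrow> Phi3star (omega * x) = Phi3star x"
  by (simp add: Phi3star_eq F2_omega G2_omega power_mult_distrib omega_cube)

text \<open>Since \<open>omega ^ 3 = 1\<close>, the rotation permutes the three linear factors
  cyclically.\<close>

lemma radical_omega: "radical a b c (omega * x) = radical c a b x"
proof -
  have *: "omega\<^sup>2 * (omega * x) = x" "omega * (omega * x) = omega\<^sup>2 * x"
    using omega_cube by (simp_all add: power2_eq_square power3_eq_cube flip: mult.assoc)
  show ?thesis unfolding radical_def * by (simp only: mult_ac)
qed

lemma uniformizer_omega: "uniformizer (omega * x) = omega * uniformizer x"
  by (simp add: uniformizer_def radical_omega F2_omega G2_omega)

text \<open>Both sides have the expansion \<open>fps_g\<close>, so they agree with its sum near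
  0.\<close>

lemma radical_eq_hyp3F2:
  "eventually (\<lambda>x. radical (-1/42) (5/42) (17/42) x * F2 x powr (-1/6) =
     hyp3F2 (-1/42) (5/42) (17/42) (1/3) (2/3) (Phi3star x)
     + 1 / (1 - 2 * omega) * (uniformizer x * hyp3F2 (13/42) (19/42) (31/42) (2/3) (4/3) (Phi3star x))
     + 3 / (21 + 7 * omega) *
       (uniformizer x ^ 2 * hyp3F2 (9/14) (11/14) (15/14) (4/3) (5/3) (Phi3star x))) (nhds 0)"
  (is "eventually (\<lambda>x. ?l x = ?r x) _")
proof -
  have "?l has_fps_expansion fps_g"
    unfolding fps_g_def by (intro has_fps_expansion_mult radical_expansion has_fps_expansion_fps_powr
      F2_expansion fps_F2_nth_0)
  moreover have "?r has_fps_expansion fps_g"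
  proof -
    have H: "(\<lambda>x. hyp3F2 a1 a2 a3 b1 b2 (Phi3star x)) has_fps_expansion (fps_hyp3F2 a1 a2 a3 b1 b2 oo pb.z)"
      if "hyp3F2 a1 a2 a3 b1 b2 has_fps_expansion fps_hyp3F2 a1 a2 a3 b1 b2" for a1 a2 a3 b1 b2
      using has_fps_expansion_compose[OF that Phi3star_expansion pb.z_nth_0] by (simp add: o_def)
    show ?thesis
      unfolding fps_g_eq
      by (intro has_fps_expansion_add has_fps_expansion_cmult_left has_fps_expansion_mult H
          uniformizer_expansion has_fps_expansion_power has_fps_expansion_hyp3F2)
         (rule minus_1_42_add_of_nat_nz divide_numeral_add_of_nat_nz)+
  qed
  ultimately have "eventually (\<lambda>x. eval_fps fps_g x = ?l x) (nhds 0)"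
    "eventually (\<lambda>x. eval_fps fps_g x = ?r x) (nhds 0)"
    by (simp_all add: has_fps_expansion_def)
  thus ?thesis by eventually_elim simp
qed

lemma eventually_mult_left_nhds_0:
  fixes c :: complex
  assumes "eventually P (nhds 0)"
  shows "eventually (\<lambda>x. P (c * x)) (nhds 0)"
proof -
  have "((\<lambda>x. c * x) \<longlongrightarrow> 0) (nhds 0)"
    by (auto intro!: tendsto_eq_intros simp: filterlim_ident)
  thus ?thesis using assms by (rule eventually_compose_filterlim[rotated])
qed

lemma hyp3F2_identities_near_0:
  "eventually (\<lambda>x.
     F2 x powr (1/6) * hyp3F2 (-1/42) (5/42) (17/42) (1/3) (2/3) (Phi3star x)
        = 1/3 * (radical (-1/42) (5/42) (17/42) x + radical (5/42) (17/42) (-1/42) x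
               + radical (17/42) (-1/42) (5/42) x) \<and>
     x * G2 x / (1 - 2 * omega) * F2 x powr (-13/6)
          * hyp3F2 (13/42) (19/42) (31/42) (2/3) (4/3) (Phi3star x)
        = 1/3 * (radical (13/42) (19/42) (31/42) x + omega * radical (19/42) (31/42) (13/42) x
               + omega\<^sup>2 * radical (31/42) (13/42) (19/42) x) \<and>
     3 * x\<^sup>2 * (G2 x)\<^sup>2 / (21 + 7 * omega) * F2 x powr (-9/2)
          * hyp3F2 (9/14) (11/14) (15/14) (4/3) (5/3) (Phi3star x)
        = 1/3 * (radical (9/14) (11/14) (15/14) x + omega\<^sup>2 * radical (11/14) (15/14) (9/14) x
               + omega * radical (15/14) (9/14) (11/14) x)) (nhds 0)"
proof -
  let ?w = omega
  have ne: "eventually (\<lambda>x::complex. x \<noteq> 1) (nhds 0)"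
    using eventually_nhds_in_open[of "- {1::complex}" 0] by (simp add: open_Compl)
  have "(F2 \<longlongrightarrow> F2 0) (nhds 0)"
    using has_fps_expansion_imp_continuous[OF F2_expansion, of UNIV]
    by (simp add: continuous_def tendsto_nhds_iff)
  hence F2: "eventually (\<lambda>x. F2 x \<noteq> 0) (nhds 0)"
    by (rule tendsto_imp_eventually_ne) (simp add: F2_def)
  \<comment> \<open>The same identity is used at \<open>x\<close>, \<open>omega * x\<close> and
    \<open>omega^2 * x\<close>.\<close>
  note K = radical_eq_hyp3F2
  note K1 = eventually_mult_left_nhds_0[OF K, of ?w]
  note K2 = eventually_mult_left_nhds_0[OF K1, of ?w]
  note ne1 = eventually_mult_left_nhds_0[OF ne, of ?w]
  note ne2 = eventually_mult_left_nhds_0[OF ne1, of ?w]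
  show ?thesis
    using K K1 K2 ne ne1 ne2 F2
  proof eventually_elim
    case (elim x)
    define h0 h1 h2 where "h0 = hyp3F2 (-1/42) (5/42) (17/42) (1/3) (2/3) (Phi3star x)"
      and "h1 = hyp3F2 (13/42) (19/42) (31/42) (2/3) (4/3) (Phi3star x)"
      and "h2 = hyp3F2 (9/14) (11/14) (15/14) (4/3) (5/3) (Phi3star x)"
    define p c1 c2 e where "p = uniformizer x" and "c1 = 1 / (1 - 2 * omega)"
      and "c2 = 3 / (21 + 7 * omega)" and "e = F2 x powr (-1/6)"
    define A0 A1 A2 where "A0 = radical (-1/42) (5/42) (17/42) x"
      and "A1 = radical (17/42) (-1/42) (5/42) x" and "A2 = radical (5/42) (17/42) (-1/42) x"
    define R Rm q Ep where "R = radical (1/3) (1/3) (1/3) x" and "Rm = radical (-1/3) (-1/3) (-1/3) x"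
      and "q = F2 x powr (-7/3)" and "Ep = F2 x powr (1/6)"
    note simps = radical_omega uniformizer_omega F2_omega Phi3star_omega[OF elim(4,5)]
      Phi3star_omega[OF elim(5,6)]
    have eq0: "A0 * e = h0 + c1 * (p * h1) + c2 * (p\<^sup>2 * h2)"
      using elim(1) by (simp only: A0_def e_def h0_def h1_def h2_def p_def c1_def c2_def)
    have eq1: "A1 * e = h0 + c1 * ((omega * p) * h1) + c2 * ((omega * p)\<^sup>2 * h2)"
      using elim(2) by (simp only: simps A1_def e_def h0_def h1_def h2_def p_def c1_def c2_def)
    have eq2: "A2 * e = h0 + c1 * ((omega * (omega * p)) * h1) + c2 * ((omega * (omega * p))\<^sup>2 * h2)"
      using elim(3) by (simp only: simps A2_def e_def h0_def h1_def h2_def p_def c1_def c2_def)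
    have eE: "e * Ep = 1"
      using elim(7) by (simp add: e_def Ep_def flip: powr_add)
    have "omega\<^sup>2 * x \<noteq> 1" using elim(6) by (simp add: power2_eq_square mult.assoc)
    hence RR: "Rm * R = 1"
      using elim(4,5) by (simp add: R_def Rm_def radical_mult) (simp add: radical_def)
    have p: "p = x * G2 x * Rm * q"
      by (simp add: p_def uniformizer_def Rm_def q_def)
    \<comment> \<open>Discrete Fourier inversion: each choice of weights keeps one of the three
      terms and kills the others by \<open>1 + omega + omega^2 = 0\<close>.\<close>
    have sum0: "(A0 + A1 + A2) * e = 3 * h0"
      using eq0 eq1 eq2 omega_square by algebra
    have sum1: "(A0 + omega * A2 + omega\<^sup>2 * A1) * e = 3 * c1 * p * h1"
      using eq0 eq1 eq2 omega_square by algebra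
    have sum2: "(A0 + omega\<^sup>2 * A2 + omega * A1) * e = 3 * c2 * p\<^sup>2 * h2"
      using eq0 eq1 eq2 omega_square by algebra
    have I0: "Ep * h0 = 1/3 * (A0 + A2 + A1)"
      using sum0 eE by algebra
    \<comment> \<open>\<open>Ep\<close> cancels \<open>e\<close>, and \<open>R\<close> cancels the
      factor \<open>Rm\<close> of \<open>p\<close>; the third identity contains \<open>p\<close>
      squared and needs \<open>R\<close> twice.\<close>
    have I1: "x * G2 x * c1 * (q * Ep) * h1 = 1/3 * (A0 * R + omega * (A2 * R) + omega\<^sup>2 * (A1 * R))"
      using sum1 eE RR p by algebra
    have I2: "x\<^sup>2 * (G2 x)\<^sup>2 * c2 * (q\<^sup>2 * Ep) * h2 =
        1/3 * (A0 * (R * R) + omega\<^sup>2 * (A2 * (R * R)) + omega * (A1 * (R * R)))"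
      using sum2 eE RR p by algebra
    \<comment> \<open>\<open>-7/3 + 1/6 = -13/6\<close> and
      \<open>-14/3 + 1/6 = -9/2\<close>.\<close>
    have q1: "q * Ep = F2 x powr (-13/6)" and q2: "q\<^sup>2 * Ep = F2 x powr (-9/2)"
      by (simp_all add: q_def Ep_def power2_eq_square flip: powr_add)
    have R1: "A0 * R = radical (13/42) (19/42) (31/42) x" "A2 * R = radical (19/42) (31/42) (13/42) x"
      "A1 * R = radical (31/42) (13/42) (19/42) x"
      by (simp_all add: A0_def A1_def A2_def R_def radical_mult)
    have R2: "A0 * (R * R) = radical (9/14) (11/14) (15/14) x" "A2 * (R * R) = radical (11/14) (15/14) (9/14) x"
      "A1 * (R * R) = radical (15/14) (9/14) (11/14) x"
      by (simp_all add: A0_def A1_def A2_def R_def radical_mult)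
    show ?case
      using I0 I1 I2 unfolding q1 q2 R1 R2
      by (simp add: A0_def A1_def A2_def Ep_def h0_def h1_def h2_def c1_def c2_def mult_ac)
  qed
qed

theorem mainTheorem7:
  shows "(\<forall>x::complex. x^3 \<noteq> 1 \<and> F2 x \<noteq> 0 \<and> G0 (mu x) \<noteq> 0 \<and> G1 (mu x) \<noteq> 0
            \<and> Phi3 (mu x) \<noteq> 0 \<longrightarrow>
           Phi3star x = (24* omega + 8) * x^3 * (G2 x)^3 / ((1 - x^3) * (F2 x)^7))
   \<and> (\<forall>\<^sub>F x in nhds (0::complex).
        F2 x powr (1/6) * hyp3F2 (-1/42) (5/42) (17/42) (1/3) (2/3) (Phi3star x)
        = 1/3 * ((1 - x) powr (-1/42) * (1 - omega*x) powr (5/42) * (1 - omega^2*x) powr (17/42)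
               + (1 - x) powr (5/42) * (1 - omega*x) powr (17/42) * (1 - omega^2*x) powr (-1/42)
               + (1 - x) powr (17/42) * (1 - omega*x) powr (-1/42) * (1 - omega^2*x) powr (5/42)))
   \<and> (\<forall>\<^sub>F x in nhds (0::complex).
        x * G2 x / (1 - 2* omega) * F2 x powr (-13/6)
          * hyp3F2 (13/42) (19/42) (31/42) (2/3) (4/3) (Phi3star x)
        = 1/3 * ((1 - x) powr (13/42) * (1 - omega*x) powr (19/42) * (1 - omega^2*x) powr (31/42)
               + omega * (1 - x) powr (19/42) * (1 - omega*x) powr (31/42) * (1 - omega^2*x) powr (13/42)
               + omega^2 * (1 - x) powr (31/42) * (1 - omega*x) powr (13/42) * (1 - omega^2*x) powr (19/42)))
   \<and> (\<forall>\<^sub>F x in nhds (0::complex).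
        3 * x^2 * (G2 x)^2 / (21 + 7* omega) * F2 x powr (-9/2)
          * hyp3F2 (9/14) (11/14) (15/14) (4/3) (5/3) (Phi3star x)
        = 1/3 * ((1 - x) powr (9/14) * (1 - omega*x) powr (11/14) * (1 - omega^2*x) powr (15/14)
               + omega^2 * (1 - x) powr (11/14) * (1 - omega*x) powr (15/14) * (1 - omega^2*x) powr (9/14)
               + omega * (1 - x) powr (15/14) * (1 - omega*x) powr (9/14) * (1 - omega^2*x) powr (11/14)))"
proof (intro conjI allI impI)
  fix x :: complex
  assume "x^3 \<noteq> 1 \<and> F2 x \<noteq> 0 \<and> G0 (mu x) \<noteq> 0 \<and> G1 (mu x) \<noteq> 0 \<and> Phi3 (mu x) \<noteq> 0"
  hence "x \<noteq> 1" by auto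
  thus "Phi3star x = (24* omega + 8) * x^3 * (G2 x)^3 / ((1 - x^3) * (F2 x)^7)"
    by (rule Phi3star_eq)
qed (use hyp3F2_identities_near_0 in \<open>eventually_elim, simp only: radical_def mult.assoc\<close>)+

end
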